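(* Let $H:\mathbb{T}^d\times\mathbb{R}^d\times\mathcal P(\mathbb{T}^d)\to\mathbb{R}$. Assume that there exists $C>0$ such that $$\forall x\in\mathbb{T}^d,q\in\mathbb{R}^d,\mu\in\mathcal P(\mathbb{T}^d),\quad|H(x,q,\mu)|\le C(1+|q|^2),$$ and that for a modulus of continuity $\omega$, $$\forall x,y\in\mathbb{T}^d,q\in\mathbb{R}^d,\mu,\nu\in\mathcal P(\mathbb{T}^d),\quad|H(x,q,\mu)-H(y,q,\nu)|\le\omega\big((1+|q|)(d(x,y)+\mathcal W_2(\mu,\nu))\big).$$ Let $U$ and $V$ be respectively a viscosity sub-solution and a viscosity super-solution of $$U(\mu)+\int_{\mathbb{T}^d}H(x,D_\mu U(\mu)(x),\mu)\,\mu(dx)=0\quad\text{in }\mathcal P(\mathbb{T}^d).$$ Then $U\le V$.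
   Context: $\mathbb{T}^d=\mathbb{R}^d/\mathbb{Z}^d$ with distance $d(x,y)=\inf_{z\in\mathbb{Z}^d}|x-y+z|$; $\exp(x,v)=x+v$ modulo $\mathbb{Z}^d$. $\mathcal P(\mathbb{T}^d)$ has the weak topology and $\mathcal W_2$ is the 2-Wasserstein distance. A modulus of continuity is a continuous concave non-decreasing $\omega:\mathbb{R}_+\to\mathbb{R}_+$, smooth on $(0,\infty)$, with $\omega(0)=0$. $\pi_i$ is the projection on the $i$-th coordinate and $f_\#\mu$ the image measure. For $\eta\in\mathcal P(\mathbb{T}^d\times\mathbb{R}^d)$, $C_{\mathbb{T}^d}(\eta)=(\int|v|^2\eta(dx,dv))^{1/2}$. Super-differential: for $U:\mathcal P(\mathbb{T}^d)\to\mathbb{R}$ and $\mu\in\mathcal P(\mathbb{T}^d)$, a measurable $\psi:\mathbb{T}^d\to\mathcal P(\mathbb{R}^d)$, $x\mapsto\psi_x$, belongs to $\partial^+U(\mu)$ if $\int_{\mathbb{T}^d}\int_{\mathbb{R}^d}|z|^2\psi_x(dz)\mu(dx)<\infty$ and there is a modulus of continuity $\omega$ such that for any $\eta\in\mathcal P(\mathbb{T}^d\times\mathbb{R}^d)$ with finite second moment and $(\pi_1)_\#\eta=\mu$, and any $\Gamma\in\mathcal P(\mathbb{T}^d\times\mathbb{R}^d\times\mathbb{R}^d)$ with $(\pi_1,\pi_2)_\#\Gamma=\mu(dx)\psi_x(dz)$ and $(\pi_1,\pi_3)_\#\Gamma=\eta$, $$U(\exp_\#\eta)\le U(\mu)+\int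 z\cdot v\,\Gamma(dx,dz,dv)+C_{\mathbb{T}^d}(\eta)\,\omega(C_{\mathbb{T}^d}(\eta)).$$ The sub-differential is $\partial^-V(\mu)=\{x\mapsto(-\mathrm{Id})_\#\psi_x:\psi\in\partial^+(-V)(\mu)\}$. An upper (resp. lower) semi-continuous $U:\mathcal P(\mathbb{T}^d)\to\mathbb{R}$ is a viscosity sub-solution (resp. super-solution) if for any $\mu\in\mathcal P(\mathbb{T}^d)$ and $\psi\in\partial^+U(\mu)$ (resp. $\psi\in\partial^-U(\mu)$), $$U(\mu)+\int_{\mathbb{T}^d\times\mathbb{R}^d}H(x,z,\mu)\psi_x(dz)\mu(dx)\le0\quad(\text{resp. }\ge0).$$ *)

theory Defs
  imports "HOL-Probability.Probability"
begin

section \<open>The flat torus\<close>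

definition int_lattice :: "(real ^ 'n) set" where
  "int_lattice = {z. \<forall>i. z $ i \<in> \<int>}"

lemma int_lattice_0: "0 \<in> int_lattice"
  by (simp add: int_lattice_def)

lemma int_lattice_uminus: "z \<in> int_lattice \<Longrightarrow> - z \<in> int_lattice"
  by (simp add: int_lattice_def)

lemma int_lattice_add: "z \<in> int_lattice \<Longrightarrow> w \<in> int_lattice \<Longrightarrow> z + w \<in> int_lattice"
  by (simp add: int_lattice_def)

lemma int_lattice_diff: "z \<in> int_lattice \<Longrightarrow> w \<in> int_lattice \<Longrightarrow> z - w \<in> int_lattice"
  by (simp add: int_lattice_def)

lemma int_lattice_norm_less_1:
  fixes z :: "real ^ 'n::finite"
  assumes "z \<in> int_lattice" "norm z < 1"
  shows "z = 0"
proof -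
  have "z $ i = 0" for i
  proof -
    have "\<bar>z $ i\<bar> < 1"
      using component_le_norm_cart[of z i] assms(2) by simp
    moreover have "z $ i \<in> \<int>"
      using assms(1) by (simp add: int_lattice_def)
    ultimately show ?thesis
      by (auto elim!: Ints_cases)
  qed
  then show ?thesis
    by (simp add: vec_eq_iff)
qed

quotient_type (overloaded) 'n torus = "real ^ 'n::finite" / "\<lambda>x y. x - y \<in> int_lattice"
proof (rule equivpI)
  show "reflp (\<lambda>x y::real ^ 'n. x - y \<in> int_lattice)"
    by (simp add: reflp_def int_lattice_0)
  show "symp (\<lambda>x y::real ^ 'n. x - y \<in> int_lattice)"
    unfolding symp_def by (metis int_lattice_uminus minus_diff_eq)
  show "transp (\<lambda>x y::real ^ 'n. x - y \<in> int_lattice)"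
    unfolding transp_def by (metis int_lattice_add diff_add_cancel add_diff_eq)
qed

definition lattice_dist :: "real ^ 'n::finite \<Rightarrow> real ^ 'n \<Rightarrow> real" where
  "lattice_dist x y = (INF z\<in>int_lattice. norm (x - y + z))"

lemma lattice_dist_le: "z \<in> int_lattice \<Longrightarrow> lattice_dist x y \<le> norm (x - y + z)"
  unfolding lattice_dist_def by (rule cINF_lower) (auto intro!: bdd_belowI[where m = 0])

lemma lattice_dist_approx:
  assumes "e > 0"
  obtains z where "z \<in> int_lattice" "norm (x - y + z) < lattice_dist x y + e"
proof -
  have "(INF z\<in>int_lattice. norm (x - y + z)) < lattice_dist x y + e"
    using assms by (simp add: lattice_dist_def)
  then show ?thesis
    using that int_lattice_0
    by (subst (asm) cINF_less_iff) (auto intro!: bdd_belowI[where m = 0])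
qed

lemma lattice_dist_shift_le:
  assumes "x - x' \<in> int_lattice" "y - y' \<in> int_lattice"
  shows "lattice_dist x y \<le> lattice_dist x' y'"
proof (rule field_le_epsilon)
  fix e :: real assume "e > 0"
  then obtain z where z: "z \<in> int_lattice" "norm (x' - y' + z) < lattice_dist x' y' + e"
    by (rule lattice_dist_approx)
  have "z - (x - x') + (y - y') \<in> int_lattice"
    by (rule int_lattice_add[OF int_lattice_diff[OF z(1) assms(1)] assms(2)])
  from lattice_dist_le[OF this, of x y] z(2)
  show "lattice_dist x y \<le> lattice_dist x' y' + e"
    by (simp add: algebra_simps)
qed

instantiation torus :: (finite) metric_space
begin

lift_definition dist_torus :: "'a torus \<Rightarrow> 'a torus \<Rightarrow> real" is lattice_dist
proof (rule antisym)
  fix x x' y y' :: "real ^ 'a"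
  assume *: "x - x' \<in> int_lattice" "y - y' \<in> int_lattice"
  then show "lattice_dist x y \<le> lattice_dist x' y'"
    by (rule lattice_dist_shift_le)
  from * have "x' - x \<in> int_lattice" "y' - y \<in> int_lattice"
    by (metis int_lattice_uminus minus_diff_eq)+
  then show "lattice_dist x' y' \<le> lattice_dist x y"
    by (rule lattice_dist_shift_le)
qed

definition uniformity_torus :: "('a torus \<times> 'a torus) filter" where
  "uniformity_torus = (INF e\<in>{0<..}. principal {(x, y). dist x y < e})"

definition open_torus :: "'a torus set \<Rightarrow> bool" where
  "open_torus S \<longleftrightarrow> (\<forall>x\<in>S. \<forall>\<^sub>F (x', y) in uniformity. x' = x \<longrightarrow> y \<in> S)"

instance
proof
  show "(uniformity :: ('a torus \<times> 'a torus) filter) =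
      (INF e\<in>{0<..}. principal {(x, y). dist x y < e})"
    by (rule uniformity_torus_def)
  show "open S \<longleftrightarrow> (\<forall>x\<in>S. \<forall>\<^sub>F (x', y) in uniformity. x' = x \<longrightarrow> y \<in> S)"
    for S :: "'a torus set"
    by (rule open_torus_def)
  show "dist x y = 0 \<longleftrightarrow> x = y" for x y :: "'a torus"
  proof (transfer, rule iffI)
    fix x y :: "real ^ 'a"
    assume 0: "lattice_dist x y = 0"
    obtain z where z: "z \<in> int_lattice" "norm (x - y + z) < lattice_dist x y + 1 / 2"
      by (rule lattice_dist_approx[of "1/2"]) simp_all
    have "x - y + z = 0"
    proof (rule ccontr)
      assume nz: "x - y + z \<noteq> 0"
      then have "norm (x - y + z) > 0" by simp
      then obtain w where w: "w \<in> int_lattice"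
          "norm (x - y + w) < lattice_dist x y + norm (x - y + z)"
        by (rule lattice_dist_approx)
      have "norm (z - w) = norm ((x - y + z) - (x - y + w))" by simp
      also have "\<dots> \<le> norm (x - y + z) + norm (x - y + w)"
        by (rule norm_triangle_ineq4)
      also have "\<dots> < 1" using z w 0 by simp
      finally have "z - w = 0"
        using int_lattice_norm_less_1 int_lattice_diff z w by blast
      then show False using w 0 by simp
    qed
    then have "x - y = - z" by (simp add: eq_neg_iff_add_eq_0)
    then show "x - y \<in> int_lattice" using z int_lattice_uminus by metis
  next
    fix x y :: "real ^ 'a"
    assume "x - y \<in> int_lattice"
    then have "lattice_dist x y \<le> norm (x - y + - (x - y))"
      by (intro lattice_dist_le int_lattice_uminus)
    moreover have "0 \<le> lattice_dist x y"
      unfolding lattice_dist_def using int_lattice_0 by (intro cINF_greatest) auto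
    ultimately show "lattice_dist x y = 0" by simp
  qed
  show "dist x y \<le> dist x z + dist y z" for x y z :: "'a torus"
  proof (transfer, rule field_le_epsilon)
    fix x y z :: "real ^ 'a" and e :: real
    assume "e > 0"
    then have e: "e / 2 > 0" by simp
    obtain a where a: "a \<in> int_lattice" "norm (x - z + a) < lattice_dist x z + e / 2"
      using e by (rule lattice_dist_approx)
    obtain b where b: "b \<in> int_lattice" "norm (y - z + b) < lattice_dist y z + e / 2"
      using e by (rule lattice_dist_approx)
    have "lattice_dist x y \<le> norm (x - y + (a - b))"
      using a b by (intro lattice_dist_le int_lattice_diff)
    also have "\<dots> = norm ((x - z + a) - (y - z + b))"
      by (simp add: algebra_simps)
    also have "\<dots> \<le> norm (x - z + a) + norm (y - z + b)"
      by (rule norm_triangle_ineq4)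
    finally show "lattice_dist x y \<le> lattice_dist x z + lattice_dist y z + e"
      using a b by simp
  qed
qed

end

lift_definition torus_exp :: "'n::finite torus \<Rightarrow> real ^ 'n \<Rightarrow> 'n torus" is "(+)"
  by simp


section \<open>Probability measures, weak topology and Wasserstein distance\<close>

definition prob_measures :: "'a::topological_space measure set" where
  "prob_measures = {\<mu>. prob_space \<mu> \<and> sets \<mu> = sets borel}"

definition weak_topology :: "'a::topological_space measure topology" where
  "weak_topology = topology_generated_by
     {{\<mu> \<in> prob_measures. (\<integral>x. f x \<partial>\<mu>) \<in> S} | (f :: 'a \<Rightarrow> real) S.
        continuous_on UNIV f \<and> bounded (range f) \<and> open S}"

definition weakly_usc :: "('a::topological_space measure \<Rightarrow> real) \<Rightarrow> bool" where
  "weakly_usc U \<longleftrightarrow> (\<forall>a. openin weak_topology {\<mu> \<in> prob_measures. U \<mu> < a})"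

definition weakly_lsc :: "('a::topological_space measure \<Rightarrow> real) \<Rightarrow> bool" where
  "weakly_lsc U \<longleftrightarrow> (\<forall>a. openin weak_topology {\<mu> \<in> prob_measures. a < U \<mu>})"

definition couplings ::
    "'a::topological_space measure \<Rightarrow> 'a measure \<Rightarrow> ('a \<times> 'a) measure set" where
  "couplings \<mu> \<nu> = {\<gamma> \<in> prob_measures. distr \<gamma> borel fst = \<mu> \<and> distr \<gamma> borel snd = \<nu>}"

(* Used on the torus only, where dist is bounded; on an unbounded space the Bochner
   integral would wrongly vanish on couplings of infinite cost. *)
definition wasserstein2 :: "'n::finite torus measure \<Rightarrow> 'n torus measure \<Rightarrow> real" where
  "wasserstein2 \<mu> \<nu> = sqrt (INF \<gamma>\<in>couplings \<mu> \<nu>. \<integral>p. (dist (fst p) (snd p))\<^sup>2 \<partial>\<gamma>)"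


section \<open>Moduli of continuity\<close>

definition modulus_of_continuity :: "(real \<Rightarrow> real) \<Rightarrow> bool" where
  "modulus_of_continuity \<omega> \<longleftrightarrow>
     \<omega> \<in> {0..} \<rightarrow> {0..} \<and> \<omega> 0 = 0 \<and>
     continuous_on {0..} \<omega> \<and> concave_on {0..} \<omega> \<and> mono_on {0..} \<omega> \<and>
     (\<forall>k. \<forall>t>0. (deriv ^^ k) \<omega> field_differentiable at t)"


section \<open>Super- and sub-differentials\<close>

(* The measure \<mu>(dx) \<psi>\<^sub>x(dz). *)
definition kernel_prod ::
    "'n::finite torus measure \<Rightarrow> ('n torus \<Rightarrow> (real ^ 'n) measure) \<Rightarrow>
      ('n torus \<times> (real ^ 'n)) measure" where
  "kernel_prod \<mu> \<psi> = \<mu> \<bind> (\<lambda>x. distr (\<psi> x) borel (\<lambda>z. (x, z)))"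

definition finite_second_moment :: "('n::finite torus \<times> (real ^ 'n)) measure \<Rightarrow> bool" where
  "finite_second_moment \<eta> \<longleftrightarrow> (\<integral>\<^sup>+p. ennreal ((norm (snd p))\<^sup>2) \<partial>\<eta>) < \<infinity>"

definition cost :: "('n::finite torus \<times> (real ^ 'n)) measure \<Rightarrow> real" where
  "cost \<eta> = sqrt (\<integral>p. (norm (snd p))\<^sup>2 \<partial>\<eta>)"

definition exp_push :: "('n::finite torus \<times> (real ^ 'n)) measure \<Rightarrow> 'n torus measure" where
  "exp_push \<eta> = distr \<eta> borel (\<lambda>(x, v). torus_exp x v)"

definition superdiff ::
    "('n::finite torus measure \<Rightarrow> real) \<Rightarrow> 'n torus measure \<Rightarrow>
      ('n torus \<Rightarrow> (real ^ 'n) measure) set" where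
  "superdiff U \<mu> =
     {\<psi> \<in> borel \<rightarrow>\<^sub>M prob_algebra borel.
        (\<integral>\<^sup>+x. \<integral>\<^sup>+z. ennreal ((norm z)\<^sup>2) \<partial>\<psi> x \<partial>\<mu>) < \<infinity> \<and>
        (\<exists>\<omega>. modulus_of_continuity \<omega> \<and>
          (\<forall>\<eta> \<in> prob_measures. \<forall>\<Gamma> \<in> prob_measures.
             finite_second_moment \<eta> \<and>
             distr \<eta> borel fst = \<mu> \<and>
             distr \<Gamma> borel (\<lambda>(x, z, v). (x, z)) = kernel_prod \<mu> \<psi> \<and>
             distr \<Gamma> borel (\<lambda>(x, z, v). (x, v)) = \<eta> \<longrightarrow>
             U (exp_push \<eta>) \<le> U \<mu> + (\<integral>(x, z, v). z \<bullet> v \<partial>\<Gamma>) + cost \<eta> * \<omega> (cost \<eta>)))}"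

definition subdiff ::
    "('n::finite torus measure \<Rightarrow> real) \<Rightarrow> 'n torus measure \<Rightarrow>
      ('n torus \<Rightarrow> (real ^ 'n) measure) set" where
  "subdiff V \<mu> = {\<lambda>x. distr (\<psi> x) borel uminus | \<psi>. \<psi> \<in> superdiff (\<lambda>\<nu>. - V \<nu>) \<mu>}"


section \<open>Viscosity solutions\<close>

(* The Bochner integral is 0 for a non-integrable integrand, so that the integral of the
   Hamiltonian exists has to be said. Under quadratic growth, it exists as soon as the
   Hamiltonian is Borel measurable in (x, z), by the second moment bound on \<psi>. *)
definition viscosity_subsolution ::
    "('n::finite torus \<Rightarrow> real ^ 'n \<Rightarrow> 'n torus measure \<Rightarrow> real) \<Rightarrow>
      ('n torus measure \<Rightarrow> real) \<Rightarrow> bool" where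
  "viscosity_subsolution H U \<longleftrightarrow> weakly_usc U \<and>
     (\<forall>\<mu> \<in> prob_measures. \<forall>\<psi> \<in> superdiff U \<mu>.
        integrable (kernel_prod \<mu> \<psi>) (\<lambda>(x, z). H x z \<mu>) \<and>
        U \<mu> + (\<integral>(x, z). H x z \<mu> \<partial>kernel_prod \<mu> \<psi>) \<le> 0)"

definition viscosity_supersolution ::
    "('n::finite torus \<Rightarrow> real ^ 'n \<Rightarrow> 'n torus measure \<Rightarrow> real) \<Rightarrow>
      ('n torus measure \<Rightarrow> real) \<Rightarrow> bool" where
  "viscosity_supersolution H V \<longleftrightarrow> weakly_lsc V \<and>
     (\<forall>\<mu> \<in> prob_measures. \<forall>\<psi> \<in> subdiff V \<mu>.
        integrable (kernel_prod \<mu> \<psi>) (\<lambda>(x, z). H x z \<mu>) \<and>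
        V \<mu> + (\<integral>(x, z). H x z \<mu> \<partial>kernel_prod \<mu> \<psi>) \<ge> 0)"

end

theory Submission
  imports Defs
begin

text \<open>
  The proof doubles the variables, but it doubles them through transport plans. A plan is a
  probability measure \<open>\<pi>(dx, dw)\<close> of a starting point \<open>x\<close> and a displacement \<open>w\<close>; it carries its first
  marginal \<open>\<mu>\<close> to the law \<open>\<nu>\<close> of \<open>exp(x, w)\<close>. Instead of \<open>U(\<mu>) - V(\<nu>) - W\<^sub>2(\<mu>, \<nu>)\<^sup>2 / 2e\<close> one
  maximizes \<open>U(\<mu>) - V(\<nu>) - \<integral>|w|\<^sup>2 d\<pi> / 2e\<close> over all plans. The penalty is then linear and weakly
  continuous in \<open>\<pi>\<close>, at least for bounded displacements, and it dominates the Wasserstein distance: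
  \<open>W\<^sub>2(\<mu>, \<nu>)\<^sup>2 \<le> \<integral>|w|\<^sup>2 d\<pi>\<close> (\<open>wasserstein2_le_plan_cost\<close>).

  A maximal plan exists (\<open>maximal_plan_exists\<close>), because displacements can be reduced modulo the
  lattice to a compact cell without changing the end point, and the probability measures on a
  compact set are weakly sequentially compact (\<open>compactly_supported_weak_limit\<close>).

  Perturb a maximal plan by following first a displacement \<open>v\<close> and then the displacement \<open>w - v\<close> to
  the old end point. Expanding \<open>|w - v|\<^sup>2\<close> shows that the conditional law of \<open>-w/e\<close> given \<open>x\<close> is a
  super-differential of \<open>U\<close> at \<open>\<mu>\<close>, with the modulus \<open>t/2e\<close> (\<open>maximal_plan_superdiff\<close>). The
  conditional law exists by \<open>disintegration_over_torus\<close>. The same statement for the reversed plan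
  shows that the conditional law of \<open>-w/e\<close> given \<open>y = exp(x, w)\<close> is a sub-differential of \<open>V\<close> at
  \<open>\<nu>\<close>. Both conditions therefore integrate the Hamiltonian at the same momentum, and subtracting
  them gives \<open>U(\<mu>) - V(\<nu>) \<le> \<integral>(H(y, -w/e, \<nu>) - H(x, -w/e, \<mu>)) d\<pi>\<close>
  (\<open>viscosity_gap_le_hamiltonian_gap\<close>). With \<open>D = \<integral>|w|\<^sup>2 d\<pi>\<close>, the regularity of the Hamiltonian and
  an affine bound \<open>\<omega>(t) \<le> \<delta> + K t\<close> bound the right-hand side by \<open>\<delta> + 2 K (\<surd>D + D/e)\<close>
  (\<open>hamiltonian_gap_le\<close>). Finally \<open>D/e\<close> tends to \<open>0\<close> along \<open>e = 2\<^sup>-\<^sup>k\<close>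
  (\<open>penalization_vanishes\<close>), whereas the maximum stays above \<open>U - V\<close> at any given measure; so
  \<open>U - V\<close> cannot be positive anywhere.
\<close>

section \<open>The torus as a compact metric space\<close>

lemma dist_torus_le_norm:
  "dist (abs_torus x) (abs_torus y) \<le> norm (x - y)"
  using lattice_dist_le[OF int_lattice_0, of x y] by (simp add: dist_torus.abs_eq)

lemma continuous_abs_torus: "continuous_on UNIV (abs_torus :: real ^ 'n::finite \<Rightarrow> _)"
  unfolding continuous_on_iff
proof (intro ballI allI impI)
  fix x :: "real ^ 'n" and e :: real
  assume "0 < e"
  then show "\<exists>d>0. \<forall>x'\<in>UNIV. dist x' x < d \<longrightarrow> dist (abs_torus x') (abs_torus x) < e"
    using dist_torus_le_norm by (auto simp: dist_norm intro!: exI[of _ e] intro: le_less_trans)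
qed

lemma abs_torus_eq_iff: "abs_torus x = abs_torus y \<longleftrightarrow> x - y \<in> int_lattice"
  by (rule torus.abs_eq_iff)

lemma surj_abs_torus: "surj abs_torus"
  by (metis Quotient_abs_rep Quotient_torus surjI)

text \<open>The projection maps the ball of radius \<open>e\<close> onto the ball of radius \<open>e\<close>: a point of the torus
  at distance less than \<open>e\<close> has a representative that is just as close.\<close>
lemma open_abs_torus_image:
  fixes S :: "(real ^ 'n::finite) set"
  assumes "open S"
  shows "open (abs_torus ` S)"
  unfolding open_dist
proof
  fix t assume "t \<in> abs_torus ` S"
  then obtain x where x: "x \<in> S" "t = abs_torus x" by auto
  obtain e where e: "e > 0" "ball x e \<subseteq> S"
    using assms x(1) open_contains_ball by metis
  have "s \<in> abs_torus ` S" if "dist s t < e" for s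
  proof -
    obtain y where y: "s = abs_torus y" using surj_abs_torus by (metis surjE)
    have "lattice_dist y x < e" using that x y by (simp add: dist_torus.abs_eq)
    then obtain z where z: "z \<in> int_lattice" "norm (y - x + z) < e"
      using lattice_dist_approx[of "e - lattice_dist y x" y x] by auto
    have "y + z \<in> S" using z(2) e(2) by (auto simp: dist_norm norm_minus_commute algebra_simps)
    moreover have "abs_torus (y + z) = s"
      using z(1) y by (simp add: abs_torus_eq_iff)
    ultimately show ?thesis by blast
  qed
  then show "\<exists>e>0. \<forall>y. dist y t < e \<longrightarrow> y \<in> abs_torus ` S" using e(1) by blast
qed

instance torus :: (finite) second_countable_topology
proof
  obtain B :: "(real ^ 'a) set set" where B: "countable B" "topological_basis B"
    using ex_countable_basis by blast
  have "topological_basis ((`) abs_torus ` B)"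
  proof (rule topological_basisI)
    fix T assume "T \<in> (`) abs_torus ` B"
    then show "open T"
      using open_abs_torus_image topological_basis_open[OF B(2)] by auto
  next
    fix T :: "'a torus set" and t assume T: "open T" "t \<in> T"
    obtain x where x: "t = abs_torus x" using surj_abs_torus by (metis surjE)
    have "open (abs_torus -` T)"
      using T(1) continuous_abs_torus by (metis continuous_on_open_vimage Int_UNIV_right open_UNIV)
    then obtain b where "b \<in> B" "x \<in> b" "b \<subseteq> abs_torus -` T"
      using topological_basisE[OF B(2), of _ x] T(2) x by (metis vimageI2)
    then show "\<exists>B'\<in>(`) abs_torus ` B. t \<in> B' \<and> B' \<subseteq> T"
      using x by (intro bexI[of _ "abs_torus ` b"]) auto
  qed
  then show "\<exists>B::'a torus set set. countable B \<and> open = generate_topology B"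
    using B(1) topological_basis_imp_subbasis by blast
qed

definition nearest_lattice_shift :: "real ^ 'n \<Rightarrow> real ^ 'n" where
  "nearest_lattice_shift w = (\<chi> i. w $ i - of_int (round (w $ i)))"

lemma torus_exp_nearest_lattice_shift [simp]:
  "torus_exp t (nearest_lattice_shift w) = torus_exp t w"
proof (transfer)
  fix t w :: "real ^ 'a"
  show "t + nearest_lattice_shift w - (t + w) \<in> int_lattice"
    by (simp add: nearest_lattice_shift_def int_lattice_def)
qed

lemma norm_nearest_lattice_shift_le: "norm (nearest_lattice_shift w) \<le> norm w"
  for w :: "real ^ 'n::finite"
proof (rule norm_le_componentwise_cart)
  fix i
  have "\<bar>w $ i - of_int (round (w $ i))\<bar> \<le> \<bar>w $ i - of_int 0\<bar>"
    by (rule round_diff_minimal)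
  then show "norm (nearest_lattice_shift w $ i) \<le> norm (w $ i)"
    by (simp add: nearest_lattice_shift_def)
qed

definition unit_cell :: "(real ^ 'n) set" where
  "unit_cell = cbox (- (\<chi> i. 1 / 2)) (\<chi> i. 1 / 2)"

lemma compact_unit_cell: "compact unit_cell"
  by (simp add: unit_cell_def)

lemma nearest_lattice_shift_in_cell: "nearest_lattice_shift w \<in> unit_cell"
proof -
  have "- (1 / 2) \<le> w $ i - of_int (round (w $ i)) \<and> w $ i - of_int (round (w $ i)) \<le> 1 / 2" for i
    using of_int_round_abs_le[of "w $ i"] by linarith
  then show ?thesis
    by (simp add: unit_cell_def nearest_lattice_shift_def mem_box_cart)
qed

lemma borel_measurable_round [measurable]: "(round :: real \<Rightarrow> int) \<in> borel \<rightarrow>\<^sub>M count_space UNIV"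
  unfolding round_def by measurable

lemma measurable_nearest_lattice_shift [measurable]:
  "(nearest_lattice_shift :: real ^ 'n::finite \<Rightarrow> _) \<in> borel_measurable borel"
proof -
  have "(\<lambda>w::real ^ 'n. nearest_lattice_shift w $ i) \<in> borel_measurable borel" for i
    unfolding nearest_lattice_shift_def vec_lambda_beta by measurable
  then show ?thesis
    by (subst borel_measurable_euclidean_space) (auto simp: Basis_vec_def inner_axis)
qed

lemma compact_torus: "compact (UNIV :: 'n::finite torus set)"
proof -
  have "t \<in> abs_torus ` (unit_cell :: (real ^ 'n) set)" for t
  proof -
    obtain x where x: "t = abs_torus x" using surj_abs_torus by (metis surjE)
    have "abs_torus (nearest_lattice_shift x) = t"
      using torus_exp_nearest_lattice_shift[of "abs_torus 0" x] x
      by (simp add: torus_exp.abs_eq del: torus_exp_nearest_lattice_shift)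
    then show ?thesis using nearest_lattice_shift_in_cell by blast
  qed
  then have "UNIV = abs_torus ` (unit_cell :: (real ^ 'n) set)" by auto
  then show ?thesis
    by (metis compact_continuous_image[OF continuous_on_subset[OF continuous_abs_torus] compact_unit_cell]
        subset_UNIV)
qed

instance torus :: (finite) complete_space
proof
  show "convergent X" if "Cauchy X" for X :: "nat \<Rightarrow> 'a torus"
    using compact_imp_complete[OF compact_torus] that by (auto simp: complete_def convergent_def)
qed

lemma dist_torus_exp_le: "dist (torus_exp x v) (torus_exp y w) \<le> dist x y + norm (v - w)"
proof (transfer, rule field_le_epsilon)
  fix x v y w :: "real ^ 'a" and e :: real
  assume "e > 0"
  then obtain z where z: "z \<in> int_lattice" "norm (x - y + z) < lattice_dist x y + e"
    by (rule lattice_dist_approx)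
  have "lattice_dist (x + v) (y + w) \<le> norm (x + v - (y + w) + z)"
    by (rule lattice_dist_le[OF z(1)])
  also have "\<dots> = norm ((x - y + z) + (v - w))" by (simp add: algebra_simps)
  also have "\<dots> \<le> norm (x - y + z) + norm (v - w)" by (rule norm_triangle_ineq)
  finally show "lattice_dist (x + v) (y + w) \<le> lattice_dist x y + norm (v - w) + e"
    using z(2) by simp
qed

lemma torus_exp_0 [simp]: "torus_exp x 0 = x"
  by transfer (simp add: int_lattice_0)

lemma torus_exp_torus_exp: "torus_exp (torus_exp x v) w = torus_exp x (v + w)"
  by transfer (simp add: int_lattice_0 algebra_simps)

lemma dist_torus_exp_self_le: "dist x (torus_exp x v) \<le> norm v"
  using dist_torus_exp_le[of x 0 x v] by simp

lemma continuous_torus_exp: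
  "continuous_on UNIV (\<lambda>p::'n::finite torus \<times> (real ^ 'n). torus_exp (fst p) (snd p))"
proof -
  have "((\<lambda>p. torus_exp (fst p) (snd p)) \<longlongrightarrow> torus_exp (fst q) (snd q)) (at q)"
    for q :: "'n torus \<times> (real ^ 'n)"
  proof (rule metric_tendsto_imp_tendsto)
    show "((\<lambda>p. dist (fst p) (fst q) + norm (snd p - snd q)) \<longlongrightarrow> 0) (at q)"
      by (rule tendsto_eq_intros refl | simp)+
    show "\<forall>\<^sub>F p in at q. dist (torus_exp (fst p) (snd p)) (torus_exp (fst q) (snd q))
        \<le> dist (dist (fst p) (fst q) + norm (snd p - snd q)) 0"
      by (intro always_eventually) (use dist_torus_exp_le in \<open>auto simp: dist_real_def\<close>)
  qed
  then show ?thesis by (simp add: continuous_on_def)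
qed

lemma measurable_torus_exp [measurable (raw)]:
  fixes f :: "'a \<Rightarrow> 'n::finite torus"
  assumes [measurable]: "f \<in> borel_measurable M" "g \<in> borel_measurable M"
  shows "(\<lambda>x. torus_exp (f x) (g x)) \<in> borel_measurable M"
proof -
  have "(\<lambda>x. (f x, g x)) \<in> borel_measurable M" by (rule borel_measurable_Pair; fact)
  from measurable_compose[OF this borel_measurable_continuous_onI[OF continuous_torus_exp]]
  show ?thesis by simp
qed

section \<open>Weak compactness of the probability measures on a compact set\<close>

definition ternary :: "(nat \<Rightarrow> real) \<Rightarrow> real" where
  "ternary a = (\<Sum>k. a k * (1 / 3) ^ Suc k)"

lemma summable_ternary:
  assumes "\<And>k. \<bar>a k\<bar> \<le> 1"
  shows "summable (\<lambda>k. a k * (1 / 3 :: real) ^ (k + m))"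
proof (rule summable_comparison_test'[where N = 0 and g = "\<lambda>k. (1 / 3 :: real) ^ k"])
  show "summable (\<lambda>k. (1 / 3 :: real) ^ k)" by (rule summable_geometric) simp
  show "norm (a n * (1 / 3) ^ (n + m)) \<le> (1 / 3) ^ n" for n
  proof -
    have "\<bar>a n\<bar> * (1 / 3) ^ (n + m) \<le> 1 * (1 / 3) ^ (n + m)"
      by (intro mult_right_mono assms) simp
    also have "\<dots> \<le> (1 / 3) ^ n" by (simp add: power_decreasing)
    finally show ?thesis by (simp add: abs_mult)
  qed
qed

lemma abs_ternary_tail_le:
  assumes "\<And>k. \<bar>a k\<bar> \<le> 1"
  shows "\<bar>\<Sum>k. a k * (1 / 3 :: real) ^ (k + m)\<bar> \<le> (1 / 3) ^ m * (3 / 2)"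
proof -
  have g: "(\<lambda>k. (1 / 3 :: real) ^ (k + m)) sums ((1 / 3) ^ m * (3 / 2))"
    using sums_mult[OF geometric_sums[of "1 / 3 :: real"], of "(1 / 3) ^ m"]
    by (simp add: power_add mult.commute)
  have "norm (\<Sum>k. a k * (1 / 3 :: real) ^ (k + m)) \<le> (\<Sum>k. (1 / 3 :: real) ^ (k + m))"
  proof (rule norm_suminf_le)
    show "summable (\<lambda>k. (1 / 3 :: real) ^ (k + m))" using g by (rule sums_summable)
    show "norm (a n * (1 / 3) ^ (n + m)) \<le> (1 / 3 :: real) ^ (n + m)" for n
      using mult_right_mono[OF assms, of "(1 / 3 :: real) ^ (n + m)" n] by (simp add: abs_mult)
  qed
  then show ?thesis using sums_unique[OF g] by simp
qed

text \<open>As only the digits 0 and 1 occur, the first digit in which two expansions differ outweighs all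
  later digits together by a factor of two. The code is therefore injective, and its inverse is
  continuous.\<close>
lemma ternary_close_imp_digits_eq:
  assumes a: "\<And>k. a k \<in> {0, 1}" and b: "\<And>k. b k \<in> {0, 1}"
    and close: "\<bar>ternary a - ternary b\<bar> < (1 / 3) ^ Suc N / 2"
    and "k \<le> N"
  shows "a k = b k"
proof (rule ccontr)
  assume "a k \<noteq> b k"
  define d where "d k = a k - b k" for k
  define j where "j = (LEAST k. d k \<noteq> 0)"
  have "d k \<noteq> 0" using \<open>a k \<noteq> b k\<close> by (simp add: d_def)
  then have dj: "d j \<noteq> 0" and jk: "j \<le> k"
    unfolding j_def by (rule LeastI[of "\<lambda>k. d k \<noteq> 0"], rule Least_le[of "\<lambda>k. d k \<noteq> 0"])
  have d0: "d i = 0" if "i < j" for i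
    using not_less_Least[of i "\<lambda>k. d k \<noteq> 0"] that by (auto simp: j_def)
  have ab: "\<bar>a i\<bar> \<le> 1" "\<bar>b i\<bar> \<le> 1" "\<bar>d i\<bar> \<le> 1" for i
    using a[of i] b[of i] by (auto simp: d_def)
  have dj1: "\<bar>d j\<bar> = 1" using dj a[of j] b[of j] by (auto simp: d_def)
  have "ternary a - ternary b = (\<Sum>i. d i * (1 / 3) ^ Suc i)"
    unfolding ternary_def d_def left_diff_distrib
    using summable_ternary[of a 1] summable_ternary[of b 1] ab
    by (intro suminf_diff) auto
  also have "\<dots> = (\<Sum>i. d (i + Suc j) * (1 / 3) ^ Suc (i + Suc j)) + (\<Sum>i<Suc j. d i * (1 / 3) ^ Suc i)"
    using summable_ternary[of d 1] ab by (intro suminf_split_initial_segment) auto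
  also have "(\<Sum>i<Suc j. d i * (1 / 3) ^ Suc i) = d j * (1 / 3) ^ Suc j"
    using d0 by simp
  finally have eq: "ternary a - ternary b =
      (\<Sum>i. d (i + Suc j) * (1 / 3) ^ (i + (j + 2))) + d j * (1 / 3) ^ Suc j" by simp
  have "\<bar>\<Sum>i. d (i + Suc j) * (1 / 3) ^ (i + (j + 2))\<bar> \<le> (1 / 3) ^ (j + 2) * (3 / 2)"
    using ab by (intro abs_ternary_tail_le) auto
  moreover have "\<bar>d j * (1 / 3) ^ Suc j\<bar> = (1 / 3) ^ Suc j" using dj1 by (simp add: abs_mult)
  ultimately have "\<bar>ternary a - ternary b\<bar> \<ge> (1 / 3) ^ Suc j / 2" unfolding eq
    by (auto simp: abs_if split: if_splits)
  moreover have "(1 / 3 :: real) ^ Suc N \<le> (1 / 3) ^ Suc j"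
    using jk \<open>k \<le> N\<close> by (intro power_decreasing) auto
  ultimately show False using close by linarith
qed

text \<open>The digits of \<open>S x\<close> record in which members of a countable basis the point \<open>x\<close> lies. Finitely many
  basic sets of diameter less than a given \<open>\<epsilon>\<close> cover \<open>K\<close>, so that points of \<open>K\<close> whose codes agree up to
  the last of their indices are \<open>\<epsilon>\<close>-close: the inverse of \<open>S\<close> on \<open>S ` K\<close> is uniformly continuous and
  extends to the closure \<open>C\<close>. Coding reduces statements on measures on \<open>K\<close> to statements on measures on
  the line, where distribution functions are available.\<close>
lemma real_coding_of_compact:
  fixes K :: "'a::{complete_space,second_countable_topology} set"
  assumes "compact K" "K \<noteq> {}"
  obtains S :: "'a \<Rightarrow> real" and G :: "real \<Rightarrow> 'a" and C where
    "S \<in> borel_measurable borel" "\<And>x. S x \<in> {0..1}" "closed C" "C \<subseteq> {0..1}" "S ` K \<subseteq> C"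
    "continuous_on C G" "\<And>t. G t \<in> K" "G \<in> borel_measurable borel" "\<And>x. x \<in> K \<Longrightarrow> G (S x) = x"
proof -
  obtain B :: "'a set set" where B: "countable B" "topological_basis B"
    using ex_countable_basis by blast
  have "B \<noteq> {}"
    using topological_basisE[OF B(2) open_UNIV] by blast
  define b where "b = from_nat_into B"
  have b: "open (b k)" for k
    using topological_basis_open[OF B(2) from_nat_into[OF \<open>B \<noteq> {}\<close>]] by (simp add: b_def)
  define S where "S x = ternary (\<lambda>k. indicator (b k) x)" for x
  have S[measurable]: "S \<in> borel_measurable borel"
    unfolding S_def ternary_def using b
    by (intro borel_measurable_suminf borel_measurable_times borel_measurable_indicator
        borel_measurable_const) auto
  have S01: "S x \<in> {0..1}" for x
  proof -
    have "\<bar>S x\<bar> \<le> 1"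
      using abs_ternary_tail_le[of "\<lambda>k. indicator (b k) x" 1] by (simp add: S_def ternary_def)
    moreover have "S x \<ge> 0" unfolding S_def ternary_def
      using summable_ternary[of "\<lambda>k. indicator (b k) x" 1] by (intro suminf_nonneg) auto
    ultimately show ?thesis by auto
  qed
  have digits: "x \<in> b k \<longleftrightarrow> y \<in> b k" if "dist (S x) (S y) < (1 / 3) ^ Suc N / 2" "k \<le> N" for x y k N
    using ternary_close_imp_digits_eq[of "\<lambda>k. indicator (b k) x" "\<lambda>k. indicator (b k) y" N k] that
    by (auto simp: S_def dist_real_def indicator_def split: if_splits)
  have close: "\<exists>d>0. \<forall>x\<in>K. \<forall>y\<in>K. dist (S x) (S y) < d \<longrightarrow> dist x y < e" if "e > 0" for e
  proof -
    define A where "A = {k. \<forall>x\<in>b k. \<forall>y\<in>b k. dist x y < e}"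
    have "K \<subseteq> (\<Union>k\<in>A. b k)"
    proof
      fix x
      obtain b' where b': "b' \<in> B" "x \<in> b'" "b' \<subseteq> ball x (e / 2)"
        using topological_basisE[OF B(2) open_ball, of x x "e / 2"] \<open>e > 0\<close> by auto
      obtain k where "b k = b'"
        using b'(1) B(1) from_nat_into_surj unfolding b_def by metis
      moreover have "k \<in> A" unfolding A_def
      proof safe
        fix y z assume "y \<in> b k" "z \<in> b k"
        then have "dist x y < e / 2" "dist x z < e / 2" using b'(3) \<open>b k = b'\<close> by auto
        then show "dist y z < e" by (rule dist_triangle_half_r)
      qed
      ultimately show "x \<in> (\<Union>k\<in>A. b k)" using b'(2) by auto
    qed
    then obtain A' where A': "A' \<subseteq> A" "finite A'" "K \<subseteq> (\<Union>k\<in>A'. b k)"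
      using compactE_image[OF \<open>compact K\<close>, of A b] b by metis
    show ?thesis
    proof (intro exI[of _ "(1 / 3) ^ Suc (Max A') / 2"] conjI ballI impI)
      fix x y assume xy: "x \<in> K" "y \<in> K" "dist (S x) (S y) < (1 / 3) ^ Suc (Max A') / 2"
      obtain k where "k \<in> A'" "x \<in> b k" using A'(3) xy(1) by auto
      moreover have "y \<in> b k"
        using digits[OF xy(3), of k] calculation A'(2) by auto
      ultimately show "dist x y < e" using A'(1) by (auto simp: A_def)
    qed simp
  qed
  have inj: "inj_on S K"
  proof (rule inj_onI, rule ccontr)
    fix x y assume "x \<in> K" "y \<in> K" "S x = S y" "x \<noteq> y"
    then obtain d where "d > 0"
        "\<And>x' y'. x' \<in> K \<Longrightarrow> y' \<in> K \<Longrightarrow> dist (S x') (S y') < d \<Longrightarrow> dist x' y' < dist x y"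
      using close[of "dist x y"] by auto
    from this(2)[of x y] this(1) show False
      using \<open>x \<in> K\<close> \<open>y \<in> K\<close> \<open>S x = S y\<close> by simp
  qed
  define I where "I = inv_into K S"
  have I: "I (S x) = x" if "x \<in> K" for x
    using inj that by (simp add: I_def)
  have "uniformly_continuous_on (S ` K) I"
    unfolding uniformly_continuous_on_def
    by (simp add: I ball_simps) (metis close dist_commute)
  then obtain g where g: "uniformly_continuous_on (closure (S ` K)) g" "\<And>t. t \<in> S ` K \<Longrightarrow> I t = g t"
    using uniformly_continuous_on_extension_on_closure by metis
  define C where "C = closure (S ` K)"
  have gc: "continuous_on C g" using g(1) unfolding C_def by (rule uniformly_continuous_imp_continuous)
  have gK: "g ` C \<subseteq> K" unfolding C_def
  proof (rule image_closure_subset)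
    show "continuous_on (closure (S ` K)) g" using gc by (simp add: C_def)
    show "closed K" using assms(1) by (rule compact_imp_closed)
    show "g ` S ` K \<subseteq> K" using g(2) I by force
  qed
  obtain x0 where x0: "x0 \<in> K" using assms(2) by auto
  define G where "G t = (if t \<in> C then g t else x0)" for t
  show thesis
  proof (rule that[of S C G])
    show "continuous_on C G" using gc by (rule continuous_on_eq) (simp add: G_def)
    show "closed C" by (simp add: C_def)
    show "C \<subseteq> {0..1}" unfolding C_def by (rule closure_minimal) (use S01 in auto)
    show SC: "S ` K \<subseteq> C" by (simp add: C_def closure_subset)
    show "G t \<in> K" for t using gK x0 by (auto simp: G_def)
    show "G (S x) = x" if "x \<in> K" for x
      using that SC g(2)[of "S x"] I[OF that] by (auto simp: G_def)
    have "closed C" by (simp add: C_def)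
    then show "G \<in> borel_measurable borel"
      unfolding G_def using gc
      by (intro borel_measurable_continuous_on_if) (auto intro: continuous_on_const)
  qed (use S01 in auto)
qed

text \<open>Helly's selection theorem applies to the laws of the codes. A continuous function on \<open>K\<close>, read
  through the decoding map, is continuous on the closed set of codes and extends to a bounded continuous
  function on the line by Tietze's theorem; so convergence of the codes in law gives weak
  convergence on \<open>K\<close>.\<close>
lemma compactly_supported_weak_limit:
  fixes \<rho> :: "nat \<Rightarrow> 'a::{complete_space,second_countable_topology} measure"
  assumes prob: "\<And>n. prob_space (\<rho> n)" and sets: "\<And>n. sets (\<rho> n) = sets borel"
    and K: "compact K" and supp: "\<And>n. AE x in \<rho> n. x \<in> K"
  obtains r m where "strict_mono r" "prob_space m" "sets m = sets borel" "AE x in m. x \<in> K"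
    "\<And>f :: 'a \<Rightarrow> real. continuous_on UNIV f \<Longrightarrow>
      (\<lambda>n. \<integral>x. f x \<partial>\<rho> (r n)) \<longlonglongrightarrow> (\<integral>x. f x \<partial>m)"
proof -
  note [measurable_cong] = sets
  have "K \<noteq> {}"
    using prob_space.AE_False[OF prob] supp[of 0] by fastforce
  obtain S :: "'a \<Rightarrow> real" and G C where code:
    "S \<in> borel_measurable borel" "\<And>x. S x \<in> {0..1}" "closed C" "C \<subseteq> {0..1}" "S ` K \<subseteq> C"
    "continuous_on C G" "\<And>t. G t \<in> K" "G \<in> borel_measurable borel" "\<And>x. x \<in> K \<Longrightarrow> G (S x) = x"
    using real_coding_of_compact[OF K \<open>K \<noteq> {}\<close>] by metis
  note [measurable] = code(1) code(8)
  have "C \<noteq> {}" using code(5) \<open>K \<noteq> {}\<close> by auto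
  have [measurable]: "C \<in> sets borel" using code(3) by auto
  define M where "M n = distr (\<rho> n) borel S" for n
  have M: "real_distribution (M n)" for n
  proof -
    interpret prob_space "\<rho> n" by (rule prob)
    show ?thesis unfolding M_def by (rule real_distribution_distr) measurable
  qed
  have S: "S x \<in> {-1<..1}" for x using code(2)[of x] by auto
  have "tight M" unfolding tight_def
  proof (intro conjI allI impI M)
    fix e :: real assume "e > 0"
    have "measure (M n) {-1<..1} > 1 - e" for n
    proof -
      interpret real_distribution "M n" by (rule M)
      have "AE t in M n. t \<in> {-1<..1}"
        unfolding M_def using S by (subst AE_distr_iff) auto
      then have "prob {-1<..1} = 1" by (subst prob_eq_1) auto
      then show ?thesis using \<open>e > 0\<close> by simp
    qed
    then show "\<exists>a b. a < b \<and> (\<forall>n. 1 - e < Sigma_Algebra.measure (M n) {a<..b})"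
      by (intro exI[of _ "-1"] exI[of _ 1]) auto
  qed
  then obtain r m where r: "strict_mono r" and m: "real_distribution m"
      and wc: "weak_conv_m (M \<circ> id \<circ> r) m"
    using tight_imp_convergent_subsubsequence[of M id] strict_mono_id by blast
  interpret m: real_distribution m by (rule m)
  have conv: "(\<lambda>n. \<integral>t. f t \<partial>M (r n)) \<longlonglongrightarrow> (\<integral>t. f t \<partial>m)"
    if "continuous_on UNIV f" "\<And>t. norm (f t) \<le> B" for f :: "real \<Rightarrow> real" and B
    using weak_conv_imp_integral_bdd_continuous_conv[of "M \<circ> id \<circ> r" m f B] M m wc that
    by (simp add: continuous_on_eq_continuous_at)
  \<comment> \<open>The code measures live on the closed set \<open>C\<close>, hence so does their limit.\<close>
  have mC: "AE t in m. t \<in> C"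
  proof -
    define f where "f t = min 1 (infdist t C)" for t
    have fc: "continuous_on UNIV f" unfolding f_def by (intro continuous_intros)
    have [measurable]: "f \<in> borel_measurable borel"
      using fc by (rule borel_measurable_continuous_onI)
    have f1: "norm (f t) \<le> 1" "0 \<le> f t" for t by (auto simp: f_def infdist_nonneg)
    have "(\<integral>t. f t \<partial>M (r n)) = 0" for n
    proof -
      have "AE x in \<rho> (r n). f (S x) = 0"
        using supp[of "r n"] by eventually_elim (use code(5) in \<open>auto simp: f_def\<close>)
      have "(\<integral>t. f t \<partial>M (r n)) = (\<integral>x. f (S x) \<partial>\<rho> (r n))"
        unfolding M_def by (rule integral_distr) measurable
      also have "\<dots> = (\<integral>x. 0 \<partial>\<rho> (r n))"
        by (rule integral_cong_AE[OF _ _ \<open>AE x in \<rho> (r n). f (S x) = 0\<close>]) measurable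
      finally show ?thesis by simp
    qed
    then have "(\<integral>t. f t \<partial>m) = 0" using conv[OF fc f1(1)] by (simp add: LIMSEQ_const_iff)
    then have "AE t in m. f t = 0"
      using f1 by (subst (asm) integral_nonneg_eq_0_iff_AE)
        (auto intro!: m.integrable_const_bound[where B = 1])
    then show ?thesis
    proof eventually_elim
      case (elim t)
      then have "infdist t C = 0" by (auto simp: f_def min_def split: if_splits)
      then show "t \<in> C" using in_closed_iff_infdist_zero[OF code(3) \<open>C \<noteq> {}\<close>] by simp
    qed
  qed
  show thesis
  proof (rule that[OF r, of "distr m borel G"])
    show "prob_space (distr m borel G)" by (rule m.prob_space_distr) measurable
    show "AE x in distr m borel G. x \<in> K"
      using code(7) compact_imp_closed[OF K] by (subst AE_distr_iff) auto
    show "(\<lambda>n. \<integral>x. f x \<partial>\<rho> (r n)) \<longlonglongrightarrow> (\<integral>x. f x \<partial>distr m borel G)"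
      if f: "continuous_on UNIV f" for f :: "'a \<Rightarrow> real"
    proof -
      have [measurable]: "f \<in> borel_measurable borel"
        using f by (rule borel_measurable_continuous_onI)
      have "compact C" using code(3,4) compact_Icc by (meson compact_eq_bounded_closed bounded_subset)
      have fG: "continuous_on C (\<lambda>t. f (G t))"
        using continuous_on_compose[OF code(6) continuous_on_subset[OF f]] by (simp add: o_def)
      then have "bounded ((\<lambda>t. f (G t)) ` C)"
        using \<open>compact C\<close> compact_continuous_image compact_imp_bounded by blast
      then obtain B where B: "\<And>t. t \<in> C \<Longrightarrow> norm (f (G t)) \<le> B" "B > 0"
        unfolding bounded_pos by auto
      obtain h where h: "continuous_on UNIV h" "\<And>t. t \<in> C \<Longrightarrow> h t = f (G t)" "\<And>t. norm (h t) \<le> B"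
        using Tietze[OF fG, of UNIV B] B code(3) by auto
      have [measurable]: "h \<in> borel_measurable borel"
        using h(1) by (rule borel_measurable_continuous_onI)
      have "(\<integral>t. h t \<partial>M (r n)) = (\<integral>x. f x \<partial>\<rho> (r n))" for n
      proof -
        have "(\<integral>t. h t \<partial>M (r n)) = (\<integral>x. h (S x) \<partial>\<rho> (r n))"
          unfolding M_def by (rule integral_distr) measurable
        also have "\<dots> = (\<integral>x. f x \<partial>\<rho> (r n))"
        proof (rule integral_cong_AE)
          show "AE x in \<rho> (r n). h (S x) = f x"
            using supp[of "r n"] by eventually_elim (use code(5,9) h(2) in auto)
        qed measurable
        finally show ?thesis .
      qed
      moreover have "(\<integral>t. h t \<partial>m) = (\<integral>x. f x \<partial>distr m borel G)"
        using mC h(2) by (subst integral_distr) (auto intro!: integral_cong_AE)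
      ultimately show ?thesis using conv[OF h(1,3)] by simp
    qed
  qed simp
qed

lemma prob_measuresD:
  assumes "\<mu> \<in> prob_measures"
  shows "prob_space \<mu>" "sets \<mu> = sets borel" "measurable \<mu> N = measurable borel N"
  using assms measurable_cong_sets[of \<mu> borel N N] by (auto simp: prob_measures_def)

lemma weak_limit_distr:
  fixes T :: "'a::topological_space \<Rightarrow> 'b::topological_space"
  assumes conv: "\<And>f :: 'a \<Rightarrow> real. continuous_on UNIV f \<Longrightarrow> (\<lambda>n. \<integral>x. f x \<partial>\<nu> n) \<longlonglongrightarrow> (\<integral>x. f x \<partial>\<mu>)"
    and prob: "\<mu> \<in> prob_measures" "\<And>n. \<nu> n \<in> prob_measures"
    and T: "continuous_on UNIV T" and g: "continuous_on UNIV (g :: 'b \<Rightarrow> real)"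
  shows "(\<lambda>n. \<integral>x. g x \<partial>distr (\<nu> n) borel T) \<longlonglongrightarrow> (\<integral>x. g x \<partial>distr \<mu> borel T)"
proof -
  have "(\<integral>x. g x \<partial>distr \<rho> borel T) = (\<integral>x. g (T x) \<partial>\<rho>)" if "\<rho> \<in> prob_measures" for \<rho>
  proof (rule integral_distr)
    show "T \<in> \<rho> \<rightarrow>\<^sub>M borel"
      unfolding prob_measuresD(3)[OF that] using T by (rule borel_measurable_continuous_onI)
    show "g \<in> borel_measurable borel" using g by (rule borel_measurable_continuous_onI)
  qed
  moreover have "continuous_on UNIV (\<lambda>x. g (T x))"
    using continuous_on_compose2[OF g T] by simp
  ultimately show ?thesis using conv[of "\<lambda>x. g (T x)"] prob by simp
qed

text \<open>Convergence against continuous bounded test functions puts the sequence eventually into each subbasic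
  open set around the limit, and hence into each open set.\<close>
lemma weakly_usc_along_limit:
  fixes \<mu> :: "'a::topological_space measure"
  assumes "weakly_usc U" and \<mu>: "\<mu> \<in> prob_measures" "\<And>n. \<nu> n \<in> prob_measures"
    and conv: "\<And>f :: 'a \<Rightarrow> real. continuous_on UNIV f \<Longrightarrow> bounded (range f) \<Longrightarrow>
      (\<lambda>n. \<integral>x. f x \<partial>\<nu> n) \<longlonglongrightarrow> (\<integral>x. f x \<partial>\<mu>)"
    and "U \<mu> < a"
  shows "\<forall>\<^sub>F n in sequentially. U (\<nu> n) < a"
proof -
  let ?S = "{{\<mu> \<in> prob_measures. (\<integral>x. f x \<partial>\<mu>) \<in> S} | (f :: 'a \<Rightarrow> real) S.
        continuous_on UNIV f \<and> bounded (range f) \<and> open S}"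
  have open_ev: "\<mu> \<in> X \<longrightarrow> (\<forall>\<^sub>F n in sequentially. \<nu> n \<in> X)" if "generate_topology_on ?S X" for X
    using that
  proof induction
    case (Int a b)
    then show ?case by (simp add: eventually_conj_iff)
  next
    case (UN K)
    show ?case
    proof
      assume "\<mu> \<in> \<Union> K"
      then obtain X where X: "X \<in> K" "\<mu> \<in> X" by blast
      then have "\<forall>\<^sub>F n in sequentially. \<nu> n \<in> X" using UN.IH[OF X(1)] by simp
      then show "\<forall>\<^sub>F n in sequentially. \<nu> n \<in> \<Union> K"
        by (rule eventually_mono) (use X in blast)
    qed
  next
    case (Basis s)
    then have "\<exists>(f :: 'a \<Rightarrow> real) S. s = {\<mu> \<in> prob_measures. (\<integral>x. f x \<partial>\<mu>) \<in> S} \<and>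
        continuous_on UNIV f \<and> bounded (range f) \<and> open S" by (simp only: mem_Collect_eq)
    then obtain f :: "'a \<Rightarrow> real" and S where f: "s = {\<mu> \<in> prob_measures. (\<integral>x. f x \<partial>\<mu>) \<in> S}"
      "continuous_on UNIV f" "bounded (range f)" "open S" by (elim exE conjE)
    show ?case
    proof
      assume "\<mu> \<in> s"
      then have "(\<integral>x. f x \<partial>\<mu>) \<in> S" by (simp add: f(1))
      then have "\<forall>\<^sub>F n in sequentially. (\<integral>x. f x \<partial>\<nu> n) \<in> S"
        by (rule topological_tendstoD[OF conv[OF f(2,3)] f(4)])
      then show "\<forall>\<^sub>F n in sequentially. \<nu> n \<in> s"
        by (rule eventually_mono) (simp add: f(1) \<mu>(2))
    qed
  qed simp
  have "openin weak_topology {\<mu> \<in> prob_measures. U \<mu> < a}"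
    using assms(1) by (simp add: weakly_usc_def)
  then have "generate_topology_on ?S {\<mu> \<in> prob_measures. U \<mu> < a}"
    by (simp add: weak_topology_def openin_topology_generated_by_iff)
  from open_ev[OF this] have "\<forall>\<^sub>F n in sequentially. \<nu> n \<in> {\<mu> \<in> prob_measures. U \<mu> < a}"
    using assms(5) \<mu>(1) by simp
  then show ?thesis by (rule eventually_mono) simp
qed

section \<open>Disintegration\<close>

lemma AE_le_of_set_nn_integral_le:
  assumes [measurable]: "f \<in> borel_measurable M" "g \<in> borel_measurable M"
    and fin: "(\<integral>\<^sup>+x. g x \<partial>M) < \<infinity>"
    and le: "\<And>A. A \<in> sets M \<Longrightarrow>
      (\<integral>\<^sup>+x. f x * indicator A x \<partial>M) \<le> (\<integral>\<^sup>+x. g x * indicator A x \<partial>M)"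
  shows "AE x in M. f x \<le> (g x :: ennreal)"
proof (rule ccontr)
  assume neg: "\<not> (AE x in M. f x \<le> g x)"
  define A where "A = {x \<in> space M. g x < f x}"
  have [measurable]: "A \<in> sets M" unfolding A_def by measurable
  have "(\<integral>\<^sup>+x. g x * indicator A x \<partial>M) < (\<integral>\<^sup>+x. f x * indicator A x \<partial>M)"
  proof (rule nn_integral_less)
    have "(\<integral>\<^sup>+x. g x * indicator A x \<partial>M) \<le> (\<integral>\<^sup>+x. g x \<partial>M)"
      by (intro nn_integral_mono) (auto simp: indicator_def)
    then show "(\<integral>\<^sup>+x. g x * indicator A x \<partial>M) \<noteq> \<infinity>" using fin by auto
    show "AE x in M. g x * indicator A x \<le> f x * indicator A x"
      by (rule AE_I2) (auto simp: A_def indicator_def)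
    show "\<not> (AE x in M. f x * indicator A x \<le> g x * indicator A x)"
    proof
      assume "AE x in M. f x * indicator A x \<le> g x * indicator A x"
      then have "AE x in M. f x \<le> g x"
        by (rule AE_mp) (rule AE_I2, auto simp: A_def indicator_def not_less split: if_splits)
      then show False using neg by simp
    qed
  qed measurable
  then show False using le[of A] by simp
qed

abbreviation uniform01 :: "real measure" where
  "uniform01 \<equiv> uniform_measure lborel {0..1}"

lemma prob_space_uniform01: "prob_space uniform01"
  by (rule prob_space_uniform_measure) auto

text \<open>This is how the randomization below turns a conditional probability into an event.\<close>
lemma emeasure_uniform01_below:
  assumes "c \<le> 1"
  shows "emeasure uniform01 {u. ennreal u < c} = c"
proof -
  define c' where "c' = enn2real c"
  have "c < top" using assms by (rule le_less_trans) simp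
  then have c: "c = ennreal c'" by (simp add: c'_def)
  have c': "0 \<le> c'" "c' \<le> 1" using assms by (simp_all add: c'_def enn2real_leI)
  have "{0..1} \<inter> {u. ennreal u < c} = {0..<c'}"
    using c' unfolding c by (auto simp: ennreal_less_iff)
  moreover have "{u. ennreal u < c} \<in> sets borel" by measurable
  ultimately show ?thesis using c' by (simp add: c divide_ennreal_def)
qed

lemma UN_half_lines: "(\<Union>n::nat. {- real n<..}) = UNIV"
proof -
  have "\<exists>n. - real n < x" for x :: real
    using reals_Archimedean2[of "- x"] by (auto simp: minus_less_iff)
  then show ?thesis by auto
qed

lemma borel_pair_eq_sigma_half_lines:
  "sets (borel :: ('a::second_countable_topology \<times> real) measure) =
    sigma_sets UNIV {A \<times> {t<..} | A t. A \<in> sets borel}"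
proof -
  have "sets ((borel :: 'a measure) \<Otimes>\<^sub>M (borel :: real measure)) =
      sets (sigma (space borel \<times> space borel)
        {a \<times> b | a b. a \<in> sets (borel :: 'a measure) \<and> b \<in> range (\<lambda>t::real. {t<..})})"
  proof (rule sets_pair_eq)
    show "sets (borel :: 'a measure) = sigma_sets (space borel) (sets borel)"
      by (rule sets.sigma_sets_eq[symmetric])
    show "countable {UNIV :: 'a set}" by simp
    show "countable (range (\<lambda>n::nat. {- real n<..}))" by simp
    show "\<Union> (range (\<lambda>n::nat. {- real n<..})) = space (borel :: real measure)"
      by (simp add: UN_half_lines)
    show "sets (borel :: real measure) = sigma_sets (space borel) (range (\<lambda>t::real. {t<..}))"
      by (subst borel_Ioi) simp
  qed auto
  moreover have "{a \<times> b | a b. a \<in> sets (borel :: 'a measure) \<and> b \<in> range (\<lambda>t::real. {t<..})} =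
      {A \<times> {t<..} | A t. A \<in> sets borel}" by auto
  ultimately show ?thesis unfolding borel_prod[symmetric] by simp
qed

text \<open>The half-lines make this criterion fit survival functions, which is how the law of the second
  coordinate is built below.\<close>
lemma measure_eq_on_half_lines:
  fixes M N :: "('a::second_countable_topology \<times> real) measure"
  assumes "finite_measure M" "sets M = sets borel" "sets N = sets borel"
    and eq: "\<And>A t. A \<in> sets borel \<Longrightarrow> emeasure M (A \<times> {t<..}) = emeasure N (A \<times> {t<..})"
  shows "M = N"
proof (rule measure_eqI_generator_eq[where \<Omega> = UNIV and A = "\<lambda>n. UNIV \<times> {- real n<..}"
      and E = "{A \<times> {t<..} | A t. A \<in> sets borel}"])
  show "Int_stable {A \<times> {t<..} | (A::'a set) (t::real). A \<in> sets borel}"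
  proof (rule Int_stableI)
    fix X Y :: "('a \<times> real) set"
    assume "X \<in> {A \<times> {t<..} | A t. A \<in> sets borel}" "Y \<in> {A \<times> {t<..} | A t. A \<in> sets borel}"
    then obtain A s B t where "X = A \<times> {s<..}" "Y = B \<times> {t<..}" "A \<in> sets borel" "B \<in> sets borel"
      by auto
    then have "X \<inter> Y = (A \<inter> B) \<times> {max s t<..}" "A \<inter> B \<in> sets borel" by auto
    then show "X \<inter> Y \<in> {A \<times> {t<..} | A t. A \<in> sets borel}" by blast
  qed
  show "(\<Union>n. UNIV \<times> {- real n<..}) = (UNIV :: ('a \<times> real) set)"
  proof -
    have "(\<Union>n. UNIV \<times> {- real n<..}) = (UNIV :: 'a set) \<times> (\<Union>n::nat. {- real n<..})" by blast
    then show ?thesis by (simp only: UN_half_lines UNIV_Times_UNIV)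
  qed
  show "emeasure M (UNIV \<times> {- real i<..}) \<noteq> \<infinity>" for i
    using finite_measure.emeasure_finite[OF assms(1)] by simp
  show "sets M = sigma_sets UNIV {A \<times> {t<..} | A t. A \<in> sets borel}"
    "sets N = sigma_sets UNIV {A \<times> {t<..} | A t. A \<in> sets borel}"
    using assms(2,3) borel_pair_eq_sigma_half_lines by simp_all
  show "emeasure M X = emeasure N X" if "X \<in> {A \<times> {t<..} | A t. A \<in> sets borel}" for X
    using that eq by blast
qed auto

lemma borel_measurable_fst [measurable]:
    "(fst :: 'a::topological_space \<times> 'b::topological_space \<Rightarrow> _) \<in> borel \<rightarrow>\<^sub>M borel"
  and borel_measurable_snd [measurable]:
    "(snd :: 'a::topological_space \<times> 'b::topological_space \<Rightarrow> _) \<in> borel \<rightarrow>\<^sub>M borel"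
  by (rule borel_measurable_continuous_onI continuous_on_fst[OF continuous_on_id]
      continuous_on_snd[OF continuous_on_id])+

text \<open>The first coordinate and an independent uniform random number \<open>u\<close> suffice to generate \<open>\<kappa>\<close>: \<open>Q (x, u)\<close>
  is the conditional quantile function, with \<open>u < P(second coordinate > q | x)\<close> for the event that it
  exceeds \<open>q\<close>. This is a disintegration whose kernel is measurable by construction. The conditional
  probabilities are only needed for countably many \<open>q\<close>, and each of their monotonicity relations holds
  almost everywhere, which is enough because the two measures are compared on one half-line at a
  time.\<close>
lemma randomization_of_second_coordinate:
  fixes \<kappa> :: "('a::second_countable_topology \<times> real) measure"
  assumes prob: "prob_space \<kappa>" and sets: "sets \<kappa> = sets borel"
    and supp: "AE p in \<kappa>. snd p \<in> {0..1}"
  obtains Q :: "'a \<times> real \<Rightarrow> real" where "Q \<in> borel_measurable borel"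
    "distr (distr \<kappa> borel fst \<Otimes>\<^sub>M uniform01) borel (\<lambda>p. (fst p, Q p)) = \<kappa>"
proof -
  interpret \<kappa>: prob_space \<kappa> by (rule prob)
  have space: "space \<kappa> = UNIV" using sets_eq_imp_space_eq[OF sets] by simp
  have fst: "fst \<in> \<kappa> \<rightarrow>\<^sub>M borel"
    unfolding measurable_cong_sets[OF sets refl] by (rule borel_measurable_fst)
  define \<mu> where "\<mu> = distr \<kappa> borel fst"
  have sets_\<mu>[measurable_cong]: "sets \<mu> = sets borel" by (simp add: \<mu>_def)
  have space_\<mu>: "space \<mu> = UNIV" by (simp add: \<mu>_def)
  interpret \<mu>: prob_space \<mu> unfolding \<mu>_def by (rule \<kappa>.prob_space_distr) (rule fst)
  interpret U: prob_space uniform01 by (rule prob_space_uniform01)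
  interpret P: pair_prob_space \<mu> uniform01 ..
  define P where "P = \<mu> \<Otimes>\<^sub>M uniform01"
  have sets_P: "sets P = sets borel"
    unfolding P_def borel_prod[symmetric] by (intro sets_pair_measure_cong) (simp_all add: sets_\<mu>)
  have space_P: "space P = UNIV" using sets_eq_imp_space_eq[OF sets_P] by simp
  have rect: "A \<times> B \<in> sets (borel :: ('a \<times> real) measure)"
    if "A \<in> sets borel" "B \<in> sets borel" for A :: "'a set" and B :: "real set"
    unfolding borel_prod[symmetric] using that by simp
  have marginal: "emeasure \<mu> A = emeasure \<kappa> (A \<times> UNIV)" if "A \<in> sets borel" for A
  proof -
    have "emeasure \<mu> A = emeasure \<kappa> (fst -` A \<inter> space \<kappa>)"
      unfolding \<mu>_def using fst that by (rule emeasure_distr)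
    also have "fst -` A \<inter> space \<kappa> = A \<times> UNIV" by (auto simp: space)
    finally show ?thesis .
  qed
  have le_marginal: "emeasure \<kappa> (A \<times> {q<..}) \<le> emeasure \<mu> A" if "A \<in> sets borel" for A q
    using rect[OF that, of UNIV] unfolding marginal[OF that]
    by (intro emeasure_mono) (auto simp: sets)
  \<comment> \<open>The density of \<open>A \<mapsto> \<kappa> (A \<times> {q<..})\<close> with respect to the first marginal is a
    version of the conditional survival function at \<open>q\<close>.\<close>
  have "\<exists>g\<in>borel_measurable \<mu>. \<forall>A\<in>sets borel.
      (\<integral>\<^sup>+x. g x * indicator A x \<partial>\<mu>) = emeasure \<kappa> (A \<times> {q<..})" for q
  proof -
    define H where "H = (UNIV :: 'a set) \<times> {q<..}"
    have H: "H \<in> sets \<kappa>" unfolding H_def sets by (rule rect) auto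
    define \<nu> where "\<nu> = distr (density \<kappa> (indicator H)) borel fst"
    have f: "fst \<in> density \<kappa> (indicator H) \<rightarrow>\<^sub>M borel" using fst by simp
    have \<nu>: "emeasure \<nu> A = emeasure \<kappa> (A \<times> {q<..})" if A: "A \<in> sets borel" for A
    proof -
      have AU: "fst -` A \<inter> space \<kappa> = A \<times> UNIV" by (auto simp: space)
      have As: "A \<times> UNIV \<in> sets \<kappa>" unfolding sets using A by (rule rect) simp
      have "emeasure \<nu> A = emeasure (density \<kappa> (indicator H)) (A \<times> UNIV)"
        unfolding \<nu>_def using f A AU by (simp add: emeasure_distr)
      also have "\<dots> = (\<integral>\<^sup>+p. indicator H p * indicator (A \<times> UNIV) p \<partial>\<kappa>)"
        using H As by (intro emeasure_density) auto
      also have "\<dots> = (\<integral>\<^sup>+p. indicator (A \<times> {q<..}) p \<partial>\<kappa>)"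
        by (intro nn_integral_cong) (auto simp: indicator_def H_def)
      also have "\<dots> = emeasure \<kappa> (A \<times> {q<..})"
        by (rule nn_integral_indicator) (unfold sets, rule rect[OF A], simp)
      finally show ?thesis .
    qed
    have "absolutely_continuous \<mu> \<nu>" unfolding absolutely_continuous_def
    proof
      fix A assume "A \<in> null_sets \<mu>"
      then have A: "A \<in> sets borel" "emeasure \<mu> A = 0" by (auto simp: sets_\<mu>)
      have "emeasure \<nu> A = 0" using le_marginal[OF A(1), of q] A(2) \<nu>[OF A(1)] by simp
      then show "A \<in> null_sets \<nu>" using A(1) by (auto simp: \<nu>_def)
    qed
    moreover have "sets \<nu> = sets \<mu>" by (simp add: \<nu>_def sets_\<mu>)
    ultimately obtain g where g: "g \<in> borel_measurable \<mu>" "density \<mu> g = \<nu>"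
      using \<mu>.Radon_Nikodym[of \<nu>] by blast
    have "(\<integral>\<^sup>+x. g x * indicator A x \<partial>\<mu>) = emeasure \<kappa> (A \<times> {q<..})" if "A \<in> sets borel" for A
      using emeasure_density[OF g(1), of A] that \<nu>[OF that] g(2) by (simp add: sets_\<mu>)
    then show ?thesis using g(1) by blast
  qed
  then obtain g where g[measurable]: "\<And>q. g q \<in> borel_measurable \<mu>"
    and gA: "\<And>q A. A \<in> sets borel \<Longrightarrow> (\<integral>\<^sup>+x. g q x * indicator A x \<partial>\<mu>) = emeasure \<kappa> (A \<times> {q<..})"
    by metis
  have g_fin: "(\<integral>\<^sup>+x. g q x \<partial>\<mu>) < \<infinity>" for q
  proof -
    have "(\<integral>\<^sup>+x. g q x \<partial>\<mu>) = emeasure \<kappa> (UNIV \<times> {q<..})" using gA[of UNIV q] by simp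
    then show ?thesis using \<kappa>.emeasure_finite by (simp flip: less_top)
  qed
  have g_mono: "AE x in \<mu>. g q' x \<le> g q x" if "q \<le> q'" for q q'
  proof (rule AE_le_of_set_nn_integral_le[OF g g g_fin])
    fix A assume "A \<in> sets \<mu>"
    then have A: "A \<in> sets borel" by (simp add: sets_\<mu>)
    have "emeasure \<kappa> (A \<times> {q'<..}) \<le> emeasure \<kappa> (A \<times> {q<..})"
      by (rule emeasure_mono) (use that rect[OF A, of "{q<..}"] in \<open>auto simp: sets\<close>)
    then show "(\<integral>\<^sup>+x. g q' x * indicator A x \<partial>\<mu>) \<le> (\<integral>\<^sup>+x. g q x * indicator A x \<partial>\<mu>)"
      by (simp add: gA[OF A])
  qed
  have g_le_1: "AE x in \<mu>. g q x \<le> 1" for q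
  proof (rule AE_le_of_set_nn_integral_le[OF g])
    fix A assume "A \<in> sets \<mu>"
    then have A: "A \<in> sets borel" by (simp add: sets_\<mu>)
    show "(\<integral>\<^sup>+x. g q x * indicator A x \<partial>\<mu>) \<le> (\<integral>\<^sup>+x. 1 * indicator A x \<partial>\<mu>)"
      using A le_marginal[OF A, of q] by (simp add: gA sets_\<mu>)
  qed (simp_all add: \<mu>.emeasure_space_1)
  define W where "W q = {p. ennreal (snd p) < g q (fst p)}" for q
  have W: "W q \<in> sets P" for q
  proof -
    have "{p \<in> space (\<mu> \<Otimes>\<^sub>M uniform01). ennreal (snd p) < g q (fst p)} \<in> sets (\<mu> \<Otimes>\<^sub>M uniform01)"
      by measurable
    then show ?thesis unfolding P_def[symmetric] space_P by (simp add: W_def)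
  qed
  have cyl: "A \<times> UNIV \<in> sets P" if "A \<in> sets borel" for A
    unfolding sets_P using that by (rule rect) simp
  have emeasure_W: "emeasure P (W q \<inter> A \<times> UNIV) = emeasure \<kappa> (A \<times> {q<..})"
    if A: "A \<in> sets borel" for A q
  proof -
    have "emeasure P (W q \<inter> A \<times> UNIV) = (\<integral>\<^sup>+x. emeasure uniform01 (Pair x -` (W q \<inter> A \<times> UNIV)) \<partial>\<mu>)"
      unfolding P_def
      by (rule U.emeasure_pair_measure_alt) (fold P_def, rule sets.Int[OF W cyl[OF A]])
    also have "\<dots> = (\<integral>\<^sup>+x. g q x * indicator A x \<partial>\<mu>)"
    proof (rule nn_integral_cong_AE)
      show "AE x in \<mu>. emeasure uniform01 (Pair x -` (W q \<inter> A \<times> UNIV)) = g q x * indicator A x"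
        using g_le_1[of q]
      proof eventually_elim
        case (elim x)
        have "Pair x -` (W q \<inter> A \<times> UNIV) = (if x \<in> A then {u. ennreal u < g q x} else {})"
          by (auto simp: W_def)
        then show ?case using emeasure_uniform01_below[OF elim] by simp
      qed
    qed
    finally show ?thesis using gA[OF A] by simp
  qed
  have W_mono: "AE p in P. p \<in> W q' \<longrightarrow> p \<in> W q" if "q \<le> q'" for q q'
    unfolding P_def
  proof (rule P.AE_pair_measure)
    have "{p \<in> space P. p \<in> W q' \<longrightarrow> p \<in> W q} = (space P - W q') \<union> W q"
      using space_P by auto
    then show "{p \<in> space (\<mu> \<Otimes>\<^sub>M uniform01). p \<in> W q' \<longrightarrow> p \<in> W q} \<in> sets (\<mu> \<Otimes>\<^sub>M uniform01)"
      unfolding P_def[symmetric] using W[of q] W[of q'] by auto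
    show "AE x in \<mu>. AE u in uniform01. (x, u) \<in> W q' \<longrightarrow> (x, u) \<in> W q"
      using g_mono[OF that]
    proof eventually_elim
      case (elim x)
      then show ?case by (intro AE_I2) (auto simp: W_def intro: less_le_trans)
    qed
  qed
  define J where "J = \<rat> \<inter> {0..1::real}"
  have J: "countable J" unfolding J_def using countable_rat by (rule countable_Int1)
  \<comment> \<open>The quantile function of the conditional law. The inserted 0 is the least possible value of the
    second coordinate; it takes over when no level of \<open>J\<close> is exceeded.\<close>
  define Q where "Q p = Sup (insert 0 {q \<in> J. p \<in> W q})" for p
  have bdd: "bdd_above (insert 0 {q \<in> J. p \<in> W q})" for p
    by (auto simp: J_def intro!: bdd_aboveI[of _ 1])
  have Q_gt: "{p. t < Q p} = (if t < 0 then UNIV else (\<Union>q\<in>{q \<in> J. t < q}. W q))" for t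
  proof -
    have "t < Q p \<longleftrightarrow> t < 0 \<or> (\<exists>q\<in>J. p \<in> W q \<and> t < q)" for p
      unfolding Q_def using bdd by (subst less_cSup_iff) auto
    then show ?thesis by auto
  qed
  have Q_borel: "Q \<in> borel_measurable borel"
  proof (rule borel_measurableI_greater)
    fix t
    have "(\<Union>q\<in>{q \<in> J. t < q}. W q) \<in> sets borel"
      using J W unfolding sets_P by (intro sets.countable_UN'') auto
    then show "{p \<in> space borel. t < Q p} \<in> sets borel" by (simp add: Q_gt)
  qed
  have Qm: "Q \<in> borel_measurable (\<mu> \<Otimes>\<^sub>M uniform01)"
    unfolding P_def[symmetric] measurable_cong_sets[OF sets_P refl] by (rule Q_borel)
  have fstm: "(\<lambda>p. fst p) \<in> \<mu> \<Otimes>\<^sub>M uniform01 \<rightarrow>\<^sub>M borel"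
    using measurable_fst[of \<mu> uniform01] unfolding measurable_cong_sets[OF refl sets_\<mu>] .
  define N where "N = distr P borel (\<lambda>p. (fst p, Q p))"
  have meas: "(\<lambda>p. (fst p, Q p)) \<in> P \<rightarrow>\<^sub>M borel"
    unfolding borel_prod[symmetric] P_def
    by (rule measurable_Pair[OF fstm Qm])
  have "N = \<kappa>"
  proof (rule measure_eq_on_half_lines)
    interpret N: prob_space N unfolding N_def P_def
      by (rule P.prob_space_distr[OF meas[unfolded P_def]])
    show "finite_measure N" by (rule N.finite_measure_axioms)
    show "sets N = sets borel" "sets \<kappa> = sets borel" by (simp_all add: N_def sets)
    fix A :: "'a set" and t :: real assume A: "A \<in> sets borel"
    have "emeasure N (A \<times> {t<..}) = emeasure P ((\<lambda>p. (fst p, Q p)) -` (A \<times> {t<..}) \<inter> space P)"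
      unfolding N_def using meas rect[OF A, of "{t<..}"] by (intro emeasure_distr) auto
    also have "(\<lambda>p. (fst p, Q p)) -` (A \<times> {t<..}) \<inter> space P = {p. t < Q p} \<inter> A \<times> UNIV"
      by (auto simp: space_P)
    finally have N_A: "emeasure N (A \<times> {t<..}) = emeasure P ({p. t < Q p} \<inter> A \<times> UNIV)" .
    show "emeasure N (A \<times> {t<..}) = emeasure \<kappa> (A \<times> {t<..})"
    proof (cases "t < 0")
      case True
      have "emeasure N (A \<times> {t<..}) = emeasure P (A \<times> UNIV)"
        using True by (simp add: N_A Q_gt)
      also have "\<dots> = emeasure \<mu> A * emeasure uniform01 UNIV"
        unfolding P_def using A by (intro U.emeasure_pair_measure_Times) (simp_all add: sets_\<mu>)
      also have "\<dots> = emeasure \<kappa> (A \<times> UNIV)"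
        using U.emeasure_space_1 marginal[OF A] by simp
      also have "\<dots> = emeasure \<kappa> (A \<times> {t<..})"
      proof (rule emeasure_eq_AE)
        show "AE p in \<kappa>. p \<in> A \<times> UNIV \<longleftrightarrow> p \<in> A \<times> {t<..}"
          using supp by eventually_elim (use True in auto)
      qed (use rect[OF A, of UNIV] rect[OF A, of "{t<..}"] in \<open>simp_all add: sets\<close>)
      finally show ?thesis .
    next
      case False
      define Jt where "Jt = {q \<in> J. t < q}"
      show ?thesis
      proof (cases "Jt = {}")
        case True
        have "\<not> t < 1"
        proof
          assume "t < 1"
          then obtain q where "q \<in> \<rat>" "t < q" "q < 1" using Rats_dense_in_real by blast
          then show False using True False by (auto simp: Jt_def J_def)
        qed
        have "emeasure \<kappa> (A \<times> {t<..}) = emeasure \<kappa> {}"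
        proof (rule emeasure_eq_AE)
          show "AE p in \<kappa>. p \<in> A \<times> {t<..} \<longleftrightarrow> p \<in> {}"
            using supp by eventually_elim (use \<open>\<not> t < 1\<close> in auto)
        qed (use rect[OF A, of "{t<..}"] in \<open>simp_all add: sets\<close>)
        moreover have "{p. t < Q p} = {}" using True False unfolding Q_gt Jt_def by auto
        ultimately show ?thesis by (simp only: N_A emeasure_empty Int_empty_left)
      next
        case nonempty: False
        define r where "r = from_nat_into Jt"
        have "countable Jt" using J by (simp add: Jt_def)
        with nonempty have r: "range r = Jt" unfolding r_def by (rule range_from_nat_into)
        define m where "m n = Min (r ` {..n})" for n
        have m_in: "m n \<in> r ` {..n}" for n
          unfolding m_def by (rule Min_in) auto
        have m_le: "m n \<le> r i" if "i \<le> n" for i n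
          unfolding m_def using that by (intro Min_le) auto
        define B where "B n = (\<Union>i\<le>n. W (r i)) \<inter> A \<times> UNIV" for n
        define D where "D n = A \<times> (\<Union>i\<le>n. {r i<..})" for n
        have D: "D n = A \<times> {m n<..}" for n
        proof -
          obtain i where i: "i \<le> n" "m n = r i" using m_in[of n] by auto
          have "(\<Union>i\<le>n. {r i<..}) = {m n<..}"
          proof (intro equalityI subsetI)
            fix x assume "x \<in> (\<Union>i\<le>n. {r i<..})"
            then obtain j where "j \<le> n" "r j < x" by auto
            then show "x \<in> {m n<..}" using m_le[of j n] by simp
          qed (use i in auto)
          then show ?thesis by (simp add: D_def)
        qed
        have Bs: "B n \<in> sets P" for n
          unfolding B_def using cyl[OF A] W by auto
        have Ds: "D n \<in> sets \<kappa>" for n unfolding D sets using A by (rule rect) simp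
        have eq: "emeasure P (B n) = emeasure \<kappa> (D n)" for n
        proof -
          have "AE p in P. \<forall>i\<in>{..n}. p \<in> W (r i) \<longrightarrow> p \<in> W (m n)"
            by (rule AE_finite_allI) (use m_le W_mono in auto)
          then have "AE p in P. p \<in> B n \<longleftrightarrow> p \<in> W (m n) \<inter> A \<times> UNIV"
            by eventually_elim (use m_in[of n] in \<open>auto simp: B_def\<close>)
          then have "emeasure P (B n) = emeasure P (W (m n) \<inter> A \<times> UNIV)"
            by (rule emeasure_eq_AE) (use Bs cyl[OF A] W in auto)
          then show ?thesis by (simp add: emeasure_W[OF A] D)
        qed
        have incB: "incseq B" and incD: "incseq D"
          unfolding incseq_def B_def D_def by (force intro: order_trans)+
        have "emeasure P (\<Union>n. B n) = (SUP n. emeasure P (B n))"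
          using Bs incB by (intro SUP_emeasure_incseq[symmetric]) auto
        also have "\<dots> = (SUP n. emeasure \<kappa> (D n))" by (simp add: eq)
        also have "\<dots> = emeasure \<kappa> (\<Union>n. D n)"
          using Ds incD by (intro SUP_emeasure_incseq) auto
        also have "(\<Union>n. D n) = A \<times> {t<..}"
        proof -
          have "(\<Union>n. D n) = A \<times> (\<Union>i. {r i<..})" unfolding D_def by auto
          also have "(\<Union>i. {r i<..}) = (\<Union>q\<in>Jt. {q<..})" unfolding r[symmetric] by simp
          also have "\<dots> = {t<..}"
          proof (intro equalityI subsetI)
            fix y assume y: "y \<in> {t<..}"
            obtain q0 where q0: "q0 \<in> Jt" using nonempty by auto
            then have "t < min y q0" using y by (auto simp: Jt_def)
            then obtain q where q: "q \<in> \<rat>" "t < q" "q < min y q0" using Rats_dense_in_real by blast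
            then have "q \<in> Jt" using q0 False by (auto simp: Jt_def J_def)
            then show "y \<in> (\<Union>q\<in>Jt. {q<..})" using q(3) by auto
          qed (auto simp: Jt_def)
          finally show ?thesis .
        qed
        also have "(\<Union>n. B n) = {p. t < Q p} \<inter> A \<times> UNIV"
        proof -
          have "(\<Union>n. B n) = (\<Union>i. W (r i)) \<inter> A \<times> UNIV" unfolding B_def by auto
          also have "(\<Union>i. W (r i)) = (\<Union>q\<in>Jt. W q)" unfolding r[symmetric] by simp
          also have "\<dots> = {p. t < Q p}" using False by (simp add: Q_gt Jt_def)
          finally show ?thesis .
        qed
        finally show ?thesis by (simp add: N_A)
      qed
    qed
  qed
  then show thesis using that[OF Q_borel] by (simp add: N_def P_def \<mu>_def)
qed

lemma prob_measures_iff_space_prob_algebra: "\<mu> \<in> prob_measures \<longleftrightarrow> \<mu> \<in> space (prob_algebra borel)"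
  by (auto simp: prob_measures_def space_prob_algebra)

lemma distr_in_prob_measures:
  assumes "\<mu> \<in> prob_measures" "f \<in> borel_measurable borel"
  shows "distr \<mu> borel f \<in> prob_measures"
proof -
  have "sets \<mu> = sets borel" using assms(1) by (simp add: prob_measures_def)
  then have "f \<in> \<mu> \<rightarrow>\<^sub>M borel" using assms(2) measurable_cong_sets[OF _ refl] by blast
  then show ?thesis using assms(1) by (simp add: prob_measures_def prob_space.prob_space_distr)
qed

lemma measurable_kernel_graph:
  fixes \<psi> :: "'n::finite torus \<Rightarrow> (real ^ 'n) measure"
  assumes "\<psi> \<in> borel \<rightarrow>\<^sub>M prob_algebra borel"
  shows "(\<lambda>x. distr (\<psi> x) borel (Pair x)) \<in> borel \<rightarrow>\<^sub>M prob_algebra borel"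
  using assms
proof (rule measurable_distr_prob_space2)
  show "(\<lambda>(x, y). (x, y)) \<in> (borel :: 'n torus measure) \<Otimes>\<^sub>M (borel :: (real ^ 'n) measure) \<rightarrow>\<^sub>M borel"
    by (simp add: borel_prod)
qed

lemma kernel_prod_in_prob_measures:
  assumes "\<psi> \<in> borel \<rightarrow>\<^sub>M prob_algebra borel" "\<mu> \<in> prob_measures"
  shows "kernel_prod \<mu> \<psi> \<in> prob_measures"
  using measurable_kernel_graph[OF assms(1)] assms(2)
  unfolding kernel_prod_def prob_measures_iff_space_prob_algebra
  by (auto simp: space_prob_algebra[of "borel :: ('a torus \<times> _) measure"] prob_space_bind' sets_bind')

lemma measurable_Pair_borel: "Pair x \<in> borel \<rightarrow>\<^sub>M borel"
  for x :: "'a::topological_space"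
  by (intro borel_measurable_continuous_onI continuous_intros)

lemma nn_integral_kernel_prod:
  assumes \<psi>: "\<psi> \<in> borel \<rightarrow>\<^sub>M prob_algebra borel" and \<mu>: "\<mu> \<in> prob_measures"
    and f: "f \<in> borel_measurable borel"
  shows "(\<integral>\<^sup>+p. f p \<partial>kernel_prod \<mu> \<psi>) = (\<integral>\<^sup>+x. \<integral>\<^sup>+z. f (x, z) \<partial>\<psi> x \<partial>\<mu>)"
proof -
  have sets_\<mu>: "sets \<mu> = sets borel" using \<mu> by (simp add: prob_measures_def)
  have sets_\<psi>: "sets (\<psi> x) = sets borel" for x
    using measurable_space[OF \<psi>, of x] by (simp add: space_prob_algebra)
  have "(\<lambda>x. distr (\<psi> x) borel (Pair x)) \<in> \<mu> \<rightarrow>\<^sub>M subprob_algebra borel"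
    using measurable_prob_algebraD[OF measurable_kernel_graph[OF \<psi>]]
    unfolding measurable_cong_sets[OF sets_\<mu> refl] .
  then have "(\<integral>\<^sup>+p. f p \<partial>kernel_prod \<mu> \<psi>) = (\<integral>\<^sup>+x. \<integral>\<^sup>+p. f p \<partial>distr (\<psi> x) borel (Pair x) \<partial>\<mu>)"
    unfolding kernel_prod_def using f by (intro nn_integral_bind)
  also have "\<dots> = (\<integral>\<^sup>+x. \<integral>\<^sup>+z. f (x, z) \<partial>\<psi> x \<partial>\<mu>)"
  proof (rule nn_integral_cong)
    fix x
    have "Pair x \<in> \<psi> x \<rightarrow>\<^sub>M borel"
      unfolding measurable_cong_sets[OF sets_\<psi> refl] by (rule measurable_Pair_borel)
    then show "(\<integral>\<^sup>+p. f p \<partial>distr (\<psi> x) borel (Pair x)) = (\<integral>\<^sup>+z. f (x, z) \<partial>\<psi> x)"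
      using f by (simp add: nn_integral_distr)
  qed
  finally show ?thesis .
qed

lemma kernel_prod_uminus:
  assumes \<psi>: "\<psi> \<in> borel \<rightarrow>\<^sub>M prob_algebra borel" and \<mu>: "\<mu> \<in> prob_measures"
  shows "kernel_prod \<mu> (\<lambda>x. distr (\<psi> x) borel uminus) =
    distr (kernel_prod \<mu> \<psi>) borel (\<lambda>p. (fst p, - snd p))"
proof -
  have sets_\<mu>: "sets \<mu> = sets borel" using \<mu> by (simp add: prob_measures_def)
  have sets_\<psi>: "sets (\<psi> x) = sets borel" for x
    using measurable_space[OF \<psi>, of x] by (simp add: space_prob_algebra)
  have Pm: "Pair x \<in> \<psi> x \<rightarrow>\<^sub>M borel" for x
    unfolding measurable_cong_sets[OF sets_\<psi> refl] by (rule measurable_Pair_borel)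
  have um: "uminus \<in> \<psi> x \<rightarrow>\<^sub>M borel" for x
    unfolding measurable_cong_sets[OF sets_\<psi> refl] by measurable
  have nm: "(\<lambda>p :: 'a torus \<times> (real ^ 'a). (fst p, - snd p)) \<in> borel \<rightarrow>\<^sub>M borel"
    by (intro borel_measurable_continuous_onI continuous_intros)
  have "(\<lambda>x. distr (\<psi> x) borel (Pair x)) \<in> \<mu> \<rightarrow>\<^sub>M subprob_algebra borel"
    using measurable_prob_algebraD[OF measurable_kernel_graph[OF \<psi>]]
    unfolding measurable_cong_sets[OF sets_\<mu> refl] .
  moreover have "space \<mu> \<noteq> {}" using \<mu> by (auto simp: prob_measures_def prob_space.not_empty)
  ultimately have "distr (kernel_prod \<mu> \<psi>) borel (\<lambda>p. (fst p, - snd p)) =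
      \<mu> \<bind> (\<lambda>x. distr (distr (\<psi> x) borel (Pair x)) borel (\<lambda>p. (fst p, - snd p)))"
    unfolding kernel_prod_def using nm by (rule distr_bind)
  also have "\<dots> = kernel_prod \<mu> (\<lambda>x. distr (\<psi> x) borel uminus)"
  proof -
    have "distr (distr (\<psi> x) borel (Pair x)) borel (\<lambda>p. (fst p, - snd p)) =
        distr (distr (\<psi> x) borel uminus) borel (Pair x)" for x
      using distr_distr[OF nm Pm[of x]] distr_distr[OF measurable_Pair_borel[of x] um[of x]]
      by (simp add: o_def)
    then show ?thesis by (simp add: kernel_prod_def)
  qed
  finally show ?thesis by simp
qed

text \<open>Code the second coordinate by a number in the unit interval, generate the code from the first
  coordinate and a uniform random number, and decode.\<close>
lemma disintegration_over_torus:
  fixes \<pi> :: "('n::finite torus \<times> (real ^ 'n)) measure"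
  assumes \<pi>: "\<pi> \<in> prob_measures" and K: "compact K" and supp: "AE p in \<pi>. snd p \<in> K"
  obtains \<psi> where "\<psi> \<in> borel \<rightarrow>\<^sub>M prob_algebra borel" "kernel_prod (distr \<pi> borel fst) \<psi> = \<pi>"
proof -
  interpret \<pi>: prob_space \<pi> using \<pi> by (simp add: prob_measures_def)
  have sets: "sets \<pi> = sets borel" using \<pi> by (simp add: prob_measures_def)
  note cong = measurable_cong_sets[OF sets refl]
  have "K \<noteq> {}" using supp \<pi>.AE_False by fastforce
  obtain S :: "real ^ 'n \<Rightarrow> real" and G C where code:
    "S \<in> borel_measurable borel" "\<And>x. S x \<in> {0..1}" "closed C" "C \<subseteq> {0..1}" "S ` K \<subseteq> C"
    "continuous_on C G" "\<And>t. G t \<in> K" "G \<in> borel_measurable borel" "\<And>x. x \<in> K \<Longrightarrow> G (S x) = x"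
    using real_coding_of_compact[OF K \<open>K \<noteq> {}\<close>] by metis
  note fst = borel_measurable_fst and snd = borel_measurable_snd
  have enc: "(\<lambda>p :: 'n torus \<times> (real ^ 'n). (fst p, S (snd p))) \<in> borel \<rightarrow>\<^sub>M borel"
    by (rule borel_measurable_Pair[OF fst measurable_compose[OF snd code(1)]])
  have dec: "(\<lambda>p :: 'n torus \<times> real. (fst p, G (snd p))) \<in> borel \<rightarrow>\<^sub>M borel"
    by (rule borel_measurable_Pair[OF fst measurable_compose[OF snd code(8)]])
  have encp: "(\<lambda>p. (fst p, S (snd p))) \<in> \<pi> \<rightarrow>\<^sub>M borel" unfolding cong by (rule enc)
  define \<kappa> where "\<kappa> = distr \<pi> borel (\<lambda>p. (fst p, S (snd p)))"
  define \<mu> where "\<mu> = distr \<pi> borel fst"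
  have \<mu>: "\<mu> \<in> prob_measures" unfolding \<mu>_def using \<pi> fst by (rule distr_in_prob_measures)
  have \<kappa>_fst: "distr \<kappa> borel fst = \<mu>"
    using distr_distr[OF fst encp] by (simp add: \<kappa>_def \<mu>_def o_def)
  have "prob_space \<kappa>" unfolding \<kappa>_def by (rule \<pi>.prob_space_distr[OF encp])
  moreover have "sets \<kappa> = sets borel" by (simp add: \<kappa>_def)
  moreover have "AE p in \<kappa>. snd p \<in> {0..1}"
  proof -
    have "{p \<in> space borel. snd p \<in> {0..1}} \<in> sets (borel :: ('n torus \<times> real) measure)"
      using measurable_sets[OF snd, of "{0..1::real}"] by (simp add: vimage_def)
    then show ?thesis
      unfolding \<kappa>_def using code(2) by (subst AE_distr_iff[OF encp]) auto
  qed
  ultimately have "thesis" if "\<And>Q :: 'n torus \<times> real \<Rightarrow> real. Q \<in> borel_measurable borel \<Longrightarrow>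
      distr (\<mu> \<Otimes>\<^sub>M uniform01) borel (\<lambda>p. (fst p, Q p)) = \<kappa> \<Longrightarrow> thesis" for thesis
    using that unfolding \<kappa>_fst[symmetric] by (rule randomization_of_second_coordinate)
  then obtain Q :: "'n torus \<times> real \<Rightarrow> real" where Q: "Q \<in> borel_measurable borel"
    "distr (\<mu> \<Otimes>\<^sub>M uniform01) borel (\<lambda>p. (fst p, Q p)) = \<kappa>"
    by blast
  interpret U: prob_space uniform01 by (rule prob_space_uniform01)
  define \<psi> where "\<psi> x = distr uniform01 borel (\<lambda>u. G (Q (x, u)))" for x
  have GQ: "(\<lambda>p. G (Q p)) \<in> borel \<rightarrow>\<^sub>M borel" by (rule measurable_compose[OF Q(1) code(8)])
  have \<psi>: "\<psi> \<in> borel \<rightarrow>\<^sub>M prob_algebra borel"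
    unfolding \<psi>_def
  proof (rule measurable_distr_prob_space2)
    show "(\<lambda>x. uniform01) \<in> borel \<rightarrow>\<^sub>M prob_algebra borel"
      by (rule measurable_const) (simp add: space_prob_algebra prob_space_uniform01)
    show "(\<lambda>(x, u). G (Q (x, u))) \<in> borel \<Otimes>\<^sub>M borel \<rightarrow>\<^sub>M borel"
      using GQ by (simp add: borel_prod split_beta')
  qed
  define P where "P = \<mu> \<Otimes>\<^sub>M uniform01"
  have sets_P: "sets P = sets borel"
    unfolding P_def borel_prod[symmetric]
    using \<mu> by (intro sets_pair_measure_cong) (simp_all add: prob_measures_def)
  have fQ: "(\<lambda>p. (fst p, Q p)) \<in> P \<rightarrow>\<^sub>M borel"
    unfolding measurable_cong_sets[OF sets_P refl] by (rule borel_measurable_Pair[OF fst Q(1)])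
  have fGQ: "(\<lambda>p. (fst p, G (Q p))) \<in> P \<rightarrow>\<^sub>M borel"
    unfolding measurable_cong_sets[OF sets_P refl] by (rule borel_measurable_Pair[OF fst GQ])
  have "kernel_prod \<mu> \<psi> = distr P borel (\<lambda>p. (fst p, G (Q p)))"
  proof (rule measure_eqI)
    show "sets (kernel_prod \<mu> \<psi>) = sets (distr P borel (\<lambda>p. (fst p, G (Q p))))"
      using kernel_prod_in_prob_measures[OF \<psi> \<mu>] by (simp add: prob_measures_def)
    fix X assume "X \<in> sets (kernel_prod \<mu> \<psi>)"
    then have X: "X \<in> sets borel"
      using kernel_prod_in_prob_measures[OF \<psi> \<mu>] by (simp add: prob_measures_def)
    have "emeasure (kernel_prod \<mu> \<psi>) X = (\<integral>\<^sup>+p. indicator X p \<partial>kernel_prod \<mu> \<psi>)"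
      using X kernel_prod_in_prob_measures[OF \<psi> \<mu>] by (simp add: prob_measures_def)
    also have "\<dots> = (\<integral>\<^sup>+x. \<integral>\<^sup>+z. indicator X (x, z) \<partial>\<psi> x \<partial>\<mu>)"
      using X by (intro nn_integral_kernel_prod[OF \<psi> \<mu>]) simp
    also have "\<dots> = (\<integral>\<^sup>+x. \<integral>\<^sup>+u. indicator X (x, G (Q (x, u))) \<partial>uniform01 \<partial>\<mu>)"
    proof (rule nn_integral_cong)
      fix x
      have "(\<lambda>u. G (Q (x, u))) \<in> borel \<rightarrow>\<^sub>M borel"
        by (rule measurable_compose[OF measurable_Pair_borel GQ])
      then have "(\<lambda>u. G (Q (x, u))) \<in> uniform01 \<rightarrow>\<^sub>M borel" by simp
      moreover have "(\<lambda>z. indicator X (x, z) :: ennreal) \<in> borel_measurable borel"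
        by (rule measurable_compose[OF measurable_Pair_borel]) (use X in simp)
      ultimately show "(\<integral>\<^sup>+z. indicator X (x, z) \<partial>\<psi> x) = (\<integral>\<^sup>+u. indicator X (x, G (Q (x, u))) \<partial>uniform01)"
        unfolding \<psi>_def by (subst nn_integral_distr) simp_all
    qed
    also have "\<dots> = (\<integral>\<^sup>+p. indicator X (fst p, G (Q p)) \<partial>P)"
    proof -
      have "(\<lambda>p. indicator X (fst p, G (Q p)) :: ennreal) \<in> borel_measurable P"
        by (rule measurable_compose[OF fGQ]) (use X in simp)
      from U.nn_integral_fst[OF this[unfolded P_def]] show ?thesis by (simp add: P_def)
    qed
    also have "\<dots> = (\<integral>\<^sup>+p. indicator X p \<partial>distr P borel (\<lambda>p. (fst p, G (Q p))))"
      by (rule nn_integral_distr[OF fGQ, symmetric]) (use X in simp)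
    also have "\<dots> = emeasure (distr P borel (\<lambda>p. (fst p, G (Q p)))) X"
      using X by simp
    finally show "emeasure (kernel_prod \<mu> \<psi>) X = emeasure (distr P borel (\<lambda>p. (fst p, G (Q p)))) X" .
  qed
  also have "\<dots> = distr \<kappa> borel (\<lambda>p. (fst p, G (snd p)))"
    using distr_distr[OF dec fQ] Q(2) by (simp add: P_def o_def)
  also have "\<dots> = distr \<pi> borel (\<lambda>p. (fst p, G (S (snd p))))"
    unfolding \<kappa>_def using distr_distr[OF dec encp] by (simp add: o_def)
  also have "\<dots> = distr \<pi> borel (\<lambda>p. p)"
  proof (rule distr_cong_AE)
    show "AE p in \<pi>. (fst p, G (S (snd p))) = p"
      using supp by eventually_elim (simp add: code(9))
    show "(\<lambda>p. (fst p, G (S (snd p)))) \<in> \<pi> \<rightarrow>\<^sub>M borel"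
      using measurable_compose[OF encp dec] by simp
    show "(\<lambda>p. p) \<in> \<pi> \<rightarrow>\<^sub>M borel" unfolding cong by simp
  qed simp_all
  also have "\<dots> = \<pi>" by (rule distr_id2) (simp add: sets)
  finally show thesis using that[OF \<psi>] by (simp add: \<mu>_def)
qed

section \<open>Plans that maximize a penalized functional\<close>

text \<open>The direct method. That the supremum is finite is a consequence as well: a subsequence along which
  \<open>F\<close> is eventually below \<open>F x + 1\<close> cannot have values tending to infinity.\<close>
lemma attains_max_if_usc_along_subsequences:
  fixes F :: "'a \<Rightarrow> real"
  assumes "X \<noteq> {}"
    and sub: "\<And>s :: nat \<Rightarrow> 'a. (\<And>n. s n \<in> X) \<Longrightarrow>
      \<exists>x\<in>X. \<exists>r. strict_mono r \<and> (\<forall>a > F x. \<forall>\<^sub>F n in sequentially. F (s (r n)) < a)"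
  shows "\<exists>x\<in>X. \<forall>y\<in>X. F y \<le> F x"
proof -
  have "bdd_above (F ` X)"
  proof (rule ccontr)
    assume "\<not> bdd_above (F ` X)"
    then have "\<forall>n::nat. \<exists>x\<in>X. F x > real n" unfolding bdd_above_def by (force simp: not_le)
    then obtain s where s: "\<And>n. s n \<in> X" "\<And>n. F (s n) > real n" by metis
    obtain x r where x: "strict_mono r" "\<And>a. a > F x \<Longrightarrow> \<forall>\<^sub>F n in sequentially. F (s (r n)) < a"
      using sub[of s] s(1) by blast
    obtain N where N: "\<And>n. n \<ge> N \<Longrightarrow> F (s (r n)) < F x + 1"
      using x(2)[of "F x + 1"] by (auto simp: eventually_sequentially)
    obtain M :: nat where M: "F x + 1 < real M" using reals_Archimedean2 by blast
    have "real M \<le> real (r (max N M))"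
      using seq_suble[OF x(1), of "max N M"] by simp
    then show False using s(2)[of "r (max N M)"] N[of "max N M"] M by simp
  qed
  define S where "S = Sup (F ` X)"
  have "\<exists>x\<in>X. F x > S - 1 / real (Suc n)" for n
    using less_cSup_iff[of "F ` X" "S - 1 / real (Suc n)"] assms(1) \<open>bdd_above (F ` X)\<close>
    by (auto simp: S_def)
  then obtain s where s: "\<And>n. s n \<in> X" "\<And>n. F (s n) > S - 1 / real (Suc n)" by metis
  obtain x r where x: "x \<in> X" "strict_mono r" "\<And>a. a > F x \<Longrightarrow> \<forall>\<^sub>F n in sequentially. F (s (r n)) < a"
    using sub[of s] s(1) by blast
  have "S \<le> F x"
  proof (rule ccontr)
    assume "\<not> S \<le> F x"
    define d where "d = (S - F x) / 2"
    have d: "d > 0" "F x < S - d" using \<open>\<not> S \<le> F x\<close> by (auto simp: d_def field_simps)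
    obtain N where N: "\<And>n. n \<ge> N \<Longrightarrow> F (s (r n)) < S - d"
      using x(3)[OF d(2)] by (auto simp: eventually_sequentially)
    obtain M where M: "1 / real (Suc M) < d" using nat_approx_posE[OF d(1)] by blast
    let ?n = "max N M"
    have "M \<le> r ?n" using seq_suble[OF x(2), of ?n] by simp
    then have "1 / real (Suc (r ?n)) \<le> 1 / real (Suc M)" by (intro divide_left_mono) auto
    then show False using s(2)[of "r ?n"] N[of ?n] M by simp
  qed
  moreover have "F y \<le> S" if "y \<in> X" for y
    unfolding S_def using that \<open>bdd_above (F ` X)\<close> by (intro cSup_upper) auto
  ultimately show ?thesis using x(1) by (meson order_trans)
qed

definition plans :: "('n::finite torus \<times> (real ^ 'n)) measure set" where
  "plans = {\<pi> \<in> prob_measures. finite_second_moment \<pi>}"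

text \<open>The doubling functional: \<open>A\<close> is evaluated at the start of the plan, \<open>B\<close> at its end. Writing the
  comparison functional as \<open>A + B\<close>, with \<open>A = U\<close> and \<open>B = -V\<close>, makes reversal of the plan
  exchange the two terms.\<close>
definition penalized ::
    "('n::finite torus measure \<Rightarrow> real) \<Rightarrow> ('n torus measure \<Rightarrow> real) \<Rightarrow> real \<Rightarrow>
      ('n torus \<times> (real ^ 'n)) measure \<Rightarrow> real" where
  "penalized A B e \<pi> = A (distr \<pi> borel fst) + B (exp_push \<pi>) - (\<integral>p. (norm (snd p))\<^sup>2 \<partial>\<pi>) / (2 * e)"

definition maximal_plan ::
    "('n::finite torus measure \<Rightarrow> real) \<Rightarrow> ('n torus measure \<Rightarrow> real) \<Rightarrow> real \<Rightarrow>
      ('n torus \<times> (real ^ 'n)) measure \<Rightarrow> bool" where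
  "maximal_plan A B e \<pi> \<longleftrightarrow> \<pi> \<in> plans \<and> (\<forall>\<pi>'\<in>plans. penalized A B e \<pi>' \<le> penalized A B e \<pi>)"

lemma measurable_exp_pair [measurable]:
  "(\<lambda>(x, v). torus_exp x v) \<in> (borel :: ('n::finite torus \<times> (real ^ 'n)) measure) \<rightarrow>\<^sub>M borel"
  unfolding split_beta' by measurable

lemma integrable_iff_second_moment:
  fixes f :: "'a::topological_space \<Rightarrow> real ^ 'n"
  assumes "\<mu> \<in> prob_measures" "f \<in> borel_measurable borel"
  shows "integrable \<mu> (\<lambda>x. (norm (f x))\<^sup>2) \<longleftrightarrow> (\<integral>\<^sup>+x. ennreal ((norm (f x))\<^sup>2) \<partial>\<mu>) < \<infinity>"
proof -
  have "(\<lambda>x. (norm (f x))\<^sup>2) \<in> borel_measurable \<mu>"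
    unfolding prob_measuresD(3)[OF assms(1)] using assms(2) by measurable
  then show ?thesis by (simp add: integrable_iff_bounded)
qed

lemma plans_iff:
  "\<pi> \<in> plans \<longleftrightarrow> \<pi> \<in> prob_measures \<and> integrable \<pi> (\<lambda>p. (norm (snd p))\<^sup>2)"
  using integrable_iff_second_moment[OF _ borel_measurable_snd]
  by (auto simp: plans_def finite_second_moment_def)

lemma continuous_exp_pair: "continuous_on UNIV (\<lambda>(x, v). torus_exp x v)"
  unfolding split_beta' by (rule continuous_torus_exp)

lemma pred_snd_in_unit_cell [measurable]:
  "Measurable.pred borel (\<lambda>p :: 'n::finite torus \<times> (real ^ 'n). snd p \<in> unit_cell)"
proof -
  have "closed (snd -` unit_cell :: ('n torus \<times> (real ^ 'n)) set)"
    using compact_imp_closed[OF compact_unit_cell] continuous_on_snd[OF continuous_on_id]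
    by (intro closed_vimage) auto
  then show ?thesis by (simp add: pred_def vimage_def)
qed

lemma AE_in_cell_imp_plan:
  fixes \<pi> :: "('n::finite torus \<times> (real ^ 'n)) measure"
  assumes "\<pi> \<in> prob_measures" "AE p in \<pi>. snd p \<in> unit_cell"
  shows "\<pi> \<in> plans"
proof -
  obtain R where R: "\<And>w :: real ^ 'n. w \<in> unit_cell \<Longrightarrow> norm w \<le> R" "R > 0"
    using compact_imp_bounded[OF compact_unit_cell] unfolding bounded_pos by metis
  interpret prob_space \<pi> using assms(1) by (simp add: prob_measures_def)
  have "AE p in \<pi>. norm ((norm (snd p))\<^sup>2) \<le> R\<^sup>2"
    using assms(2) by eventually_elim (use R in \<open>simp add: power_mono\<close>)
  moreover have "(\<lambda>p. (norm (snd p))\<^sup>2) \<in> borel_measurable \<pi>"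
    unfolding prob_measuresD(3)[OF assms(1)] by measurable
  ultimately have "integrable \<pi> (\<lambda>p. (norm (snd p))\<^sup>2)" by (rule integrable_const_bound)
  then show ?thesis using assms(1) by (simp add: plans_iff)
qed

text \<open>Replacing a displacement by its shortest representative modulo the lattice keeps both ends of the
  plan and does not increase the penalty, so maximizing over a compact set of plans loses nothing.\<close>
lemma reduce_plan_to_cell:
  fixes \<pi> :: "('n::finite torus \<times> (real ^ 'n)) measure"
  assumes \<pi>: "\<pi> \<in> plans" and "e > 0"
  obtains \<pi>' where "\<pi>' \<in> prob_measures" "AE p in \<pi>'. snd p \<in> unit_cell"
    "penalized A B e \<pi> \<le> penalized A B e \<pi>'"
proof -
  define T where "T p = (fst p, nearest_lattice_shift (snd p))" for p :: "'n torus \<times> (real ^ 'n)"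
  have T: "T \<in> borel \<rightarrow>\<^sub>M borel" unfolding T_def by (intro borel_measurable_Pair) measurable
  have \<pi>p: "\<pi> \<in> prob_measures" and int: "integrable \<pi> (\<lambda>p. (norm (snd p))\<^sup>2)"
    using \<pi> by (auto simp: plans_iff)
  have T': "T \<in> \<pi> \<rightarrow>\<^sub>M borel" using T by (simp add: prob_measuresD[OF \<pi>p])
  define \<pi>' where "\<pi>' = distr \<pi> borel T"
  have cell: "AE p in \<pi>'. snd p \<in> unit_cell"
  proof -
    have "{p \<in> space borel. snd p \<in> unit_cell} \<in> sets (borel :: ('n torus \<times> (real ^ 'n)) measure)"
      using pred_snd_in_unit_cell by (simp add: pred_def)
    then show ?thesis unfolding \<pi>'_def
      by (subst AE_distr_iff[OF T']) (auto simp: T_def nearest_lattice_shift_in_cell)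
  qed
  have \<pi>'p: "\<pi>' \<in> prob_measures" unfolding \<pi>'_def using \<pi>p T by (rule distr_in_prob_measures)
  have 1: "distr \<pi>' borel fst = distr \<pi> borel fst"
    unfolding \<pi>'_def by (subst distr_distr[OF _ T']) (auto simp: T_def o_def)
  have 2: "exp_push \<pi>' = exp_push \<pi>"
    unfolding \<pi>'_def exp_push_def
    by (subst distr_distr[OF measurable_exp_pair T']) (simp add: T_def o_def split_beta')
  have "(\<integral>p. (norm (snd p))\<^sup>2 \<partial>\<pi>') = (\<integral>p. (norm (snd (T p)))\<^sup>2 \<partial>\<pi>)"
    unfolding \<pi>'_def using T' by (rule integral_distr) measurable
  also have "\<dots> \<le> (\<integral>p. (norm (snd p))\<^sup>2 \<partial>\<pi>)"
  proof (rule integral_mono[OF _ int])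
    have *: "(norm (snd (T p)))\<^sup>2 \<le> (norm (snd p))\<^sup>2" for p
      by (simp add: T_def norm_nearest_lattice_shift_le power_mono)
    then show "(norm (snd (T p)))\<^sup>2 \<le> (norm (snd p))\<^sup>2" for p .
    show "integrable \<pi> (\<lambda>p. (norm (snd (T p)))\<^sup>2)"
    proof (rule Bochner_Integration.integrable_bound[OF int])
      show "(\<lambda>p. (norm (snd (T p)))\<^sup>2) \<in> borel_measurable \<pi>" using T' by measurable
    qed (simp add: *)
  qed
  finally have "(\<integral>p. (norm (snd p))\<^sup>2 \<partial>\<pi>') / (2 * e) \<le> (\<integral>p. (norm (snd p))\<^sup>2 \<partial>\<pi>) / (2 * e)"
    using \<open>e > 0\<close> by (simp add: divide_right_mono)
  then have "penalized A B e \<pi> \<le> penalized A B e \<pi>'" by (simp add: penalized_def 1 2)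
  with \<pi>'p cell show thesis by (rule that)
qed

text \<open>All plans compete, those with unbounded displacements included: the perturbed plans that
  establish the super-differential property need not be supported in the unit cell.\<close>
lemma maximal_plan_exists:
  fixes A B :: "'n::finite torus measure \<Rightarrow> real"
  assumes A: "weakly_usc A" and B: "weakly_usc B" and e: "e > 0"
  obtains \<pi> where "maximal_plan A B e \<pi>" "AE p in \<pi>. snd p \<in> unit_cell"
proof -
  define X where "X = {\<pi> :: ('n torus \<times> (real ^ 'n)) measure. \<pi> \<in> prob_measures \<and> (AE p in \<pi>. snd p \<in> unit_cell)}"
  have "\<exists>\<pi>\<in>X. \<forall>\<pi>'\<in>X. penalized A B e \<pi>' \<le> penalized A B e \<pi>"
  proof (rule attains_max_if_usc_along_subsequences)
    have "return borel (undefined, nearest_lattice_shift 0) \<in> X"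
      unfolding X_def mem_Collect_eq
    proof
      show "AE p in return borel (undefined :: 'n torus, nearest_lattice_shift (0 :: real ^ 'n)). snd p \<in> unit_cell"
        by (subst AE_return[OF _ pred_snd_in_unit_cell]) (simp_all add: nearest_lattice_shift_in_cell)
    qed (simp add: prob_measures_def prob_space_return)
    then show "X \<noteq> {}" by blast
    fix s :: "nat \<Rightarrow> ('n torus \<times> (real ^ 'n)) measure"
    assume s: "\<And>n. s n \<in> X"
    obtain r m where r: "strict_mono r" and m: "prob_space m" "sets m = sets borel"
        "AE p in m. p \<in> UNIV \<times> unit_cell"
      and conv: "\<And>f :: 'n torus \<times> (real ^ 'n) \<Rightarrow> real. continuous_on UNIV f \<Longrightarrow>
        (\<lambda>n. \<integral>x. f x \<partial>s (r n)) \<longlonglongrightarrow> (\<integral>x. f x \<partial>m)"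
    proof (rule compactly_supported_weak_limit[of s "UNIV \<times> unit_cell"])
      show "compact (UNIV \<times> unit_cell :: ('n torus \<times> (real ^ 'n)) set)"
        by (intro compact_Times compact_torus compact_unit_cell)
      show "prob_space (s n)" "sets (s n) = sets borel" for n
        using s[of n] by (auto simp: X_def prob_measures_def)
      show "AE p in s n. p \<in> UNIV \<times> unit_cell" for n
        using s[of n] by (auto simp: X_def mem_Times_iff)
    qed blast
    have mp: "m \<in> prob_measures" using m by (simp add: prob_measures_def)
    have sp: "s n \<in> prob_measures" for n using s[of n] by (simp add: X_def)
    show "\<exists>x\<in>X. \<exists>r. strict_mono r \<and>
        (\<forall>a > penalized A B e x. \<forall>\<^sub>F n in sequentially. penalized A B e (s (r n)) < a)"
    proof (intro bexI[of _ m] exI[of _ r] conjI allI impI r)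
      show "m \<in> X" using m(3) mp by (auto simp: X_def mem_Times_iff)
      fix a assume a: "a > penalized A B e m"
      define d where "d = (a - penalized A B e m) / 3"
      have "d > 0" using a by (simp add: d_def)
      have "\<forall>\<^sub>F n in sequentially. A (distr (s (r n)) borel fst) < A (distr m borel fst) + d"
      proof (rule weakly_usc_along_limit[OF A])
        show "(\<lambda>n. \<integral>x. f x \<partial>distr (s (r n)) borel fst) \<longlonglongrightarrow> (\<integral>x. f x \<partial>distr m borel fst)"
          if "continuous_on UNIV f" for f :: "'n torus \<Rightarrow> real"
          using conv mp sp continuous_on_fst[OF continuous_on_id] that by (rule weak_limit_distr)
      qed (use mp sp \<open>d > 0\<close> in \<open>auto intro: distr_in_prob_measures\<close>)
      moreover have "\<forall>\<^sub>F n in sequentially. B (exp_push (s (r n))) < B (exp_push m) + d"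
        unfolding exp_push_def
      proof (rule weakly_usc_along_limit[OF B])
        show "(\<lambda>n. \<integral>x. f x \<partial>distr (s (r n)) borel (\<lambda>(x, v). torus_exp x v)) \<longlonglongrightarrow>
            (\<integral>x. f x \<partial>distr m borel (\<lambda>(x, v). torus_exp x v))"
          if "continuous_on UNIV f" for f :: "'n torus \<Rightarrow> real"
          using conv mp sp continuous_exp_pair that by (rule weak_limit_distr)
      qed (use mp sp \<open>d > 0\<close> measurable_exp_pair in \<open>auto intro: distr_in_prob_measures\<close>)
      moreover have "\<forall>\<^sub>F n in sequentially.
          (\<integral>p. (norm (snd p))\<^sup>2 \<partial>m) / (2 * e) - d < (\<integral>p. (norm (snd p))\<^sup>2 \<partial>s (r n)) / (2 * e)"
      proof (rule order_tendstoD(1))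
        have "continuous_on UNIV (\<lambda>p :: 'n torus \<times> (real ^ 'n). (norm (snd p))\<^sup>2)"
          by (intro continuous_intros)
        from tendsto_divide[OF conv[OF this] tendsto_const[of "2 * e"]]
        show "(\<lambda>n. (\<integral>p. (norm (snd p))\<^sup>2 \<partial>s (r n)) / (2 * e)) \<longlonglongrightarrow> (\<integral>p. (norm (snd p))\<^sup>2 \<partial>m) / (2 * e)"
          using e by simp
      qed (use \<open>d > 0\<close> in simp)
      ultimately show "\<forall>\<^sub>F n in sequentially. penalized A B e (s (r n)) < a"
      proof eventually_elim
        case (elim n)
        have "a = penalized A B e m + 3 * d" by (simp add: d_def field_simps)
        then show ?case using elim by (simp add: penalized_def)
      qed
    qed
  qed
  then obtain \<pi> where \<pi>: "\<pi> \<in> X" "\<And>\<pi>'. \<pi>' \<in> X \<Longrightarrow> penalized A B e \<pi>' \<le> penalized A B e \<pi>" by blast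
  have "maximal_plan A B e \<pi>" unfolding maximal_plan_def
  proof (intro conjI ballI)
    show "\<pi> \<in> plans" using \<pi>(1) AE_in_cell_imp_plan by (auto simp: X_def)
    fix \<sigma> :: "('n torus \<times> (real ^ 'n)) measure" assume "\<sigma> \<in> plans"
    then obtain \<pi>' where "\<pi>' \<in> X" "penalized A B e \<sigma> \<le> penalized A B e \<pi>'"
      using reduce_plan_to_cell[OF _ e] by (metis (mono_tags, lifting) X_def mem_Collect_eq)
    then show "penalized A B e \<sigma> \<le> penalized A B e \<pi>" using \<pi>(2) by force
  qed
  then show thesis using that \<pi>(1) by (simp add: X_def)
qed

section \<open>Super-differentials at the marginals of a maximal plan\<close>

text \<open>Reversal exchanges the roles of the two ends of a plan, and thereby derives every statement about
  the end of a maximal plan from the one about its start.\<close>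
definition reverse_plan ::
    "('n::finite torus \<times> (real ^ 'n)) measure \<Rightarrow> ('n torus \<times> (real ^ 'n)) measure" where
  "reverse_plan \<pi> = distr \<pi> borel (\<lambda>(x, v). (torus_exp x v, - v))"

lemma measurable_reverse:
  "(\<lambda>(x, v). (torus_exp x v, - v)) \<in> (borel :: ('n::finite torus \<times> (real ^ 'n)) measure) \<rightarrow>\<^sub>M borel"
  unfolding split_beta' by (rule borel_measurable_Pair) measurable

lemma distr_reverse_plan:
  assumes "\<pi> \<in> prob_measures" "g \<in> borel \<rightarrow>\<^sub>M borel"
  shows "distr (reverse_plan \<pi>) borel g = distr \<pi> borel (\<lambda>p. g (torus_exp (fst p) (snd p), - snd p))"
proof -
  have T: "(\<lambda>(x, v). (torus_exp x v, - v)) \<in> \<pi> \<rightarrow>\<^sub>M borel"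
    unfolding prob_measuresD(3)[OF assms(1)] by (rule measurable_reverse)
  show ?thesis
    unfolding reverse_plan_def using distr_distr[OF assms(2) T] by (simp add: o_def split_beta')
qed

lemma AE_reverse_plan:
  assumes "\<pi> \<in> prob_measures" "Measurable.pred borel P"
  shows "(AE p in reverse_plan \<pi>. P p) \<longleftrightarrow> (AE p in \<pi>. P (torus_exp (fst p) (snd p), - snd p))"
proof -
  have T: "(\<lambda>(x, v). (torus_exp x v, - v)) \<in> \<pi> \<rightarrow>\<^sub>M borel"
    unfolding prob_measuresD(3)[OF assms(1)] by (rule measurable_reverse)
  show ?thesis
    unfolding reverse_plan_def using assms(2)
    by (subst AE_distr_iff[OF T]) (simp_all add: pred_def split_beta')
qed

lemma reverse_plan_in_prob_measures: "\<pi> \<in> prob_measures \<Longrightarrow> reverse_plan \<pi> \<in> prob_measures"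
  unfolding reverse_plan_def using measurable_reverse by (rule distr_in_prob_measures[rotated])

lemma distr_fst_reverse_plan:
  "\<pi> \<in> prob_measures \<Longrightarrow> distr (reverse_plan \<pi>) borel fst = exp_push \<pi>"
  by (simp add: distr_reverse_plan exp_push_def split_beta')

lemma exp_push_reverse_plan:
  "\<pi> \<in> prob_measures \<Longrightarrow> exp_push (reverse_plan \<pi>) = distr \<pi> borel fst"
  using distr_reverse_plan[OF _ measurable_exp_pair]
  by (simp add: exp_push_def torus_exp_torus_exp)

lemma second_moment_reverse_plan:
  assumes "\<pi> \<in> prob_measures"
  shows "integrable (reverse_plan \<pi>) (\<lambda>p. (norm (snd p))\<^sup>2) \<longleftrightarrow> integrable \<pi> (\<lambda>p. (norm (snd p))\<^sup>2)"
    and "(\<integral>p. (norm (snd p))\<^sup>2 \<partial>reverse_plan \<pi>) = (\<integral>p. (norm (snd p))\<^sup>2 \<partial>\<pi>)"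
proof -
  have T: "(\<lambda>(x, v). (torus_exp x v, - v)) \<in> \<pi> \<rightarrow>\<^sub>M borel"
    unfolding prob_measuresD(3)[OF assms] by (rule measurable_reverse)
  have f: "(\<lambda>p :: 'a torus \<times> (real ^ 'a). (norm (snd p))\<^sup>2) \<in> borel_measurable borel" by measurable
  show "integrable (reverse_plan \<pi>) (\<lambda>p. (norm (snd p))\<^sup>2) \<longleftrightarrow> integrable \<pi> (\<lambda>p. (norm (snd p))\<^sup>2)"
    unfolding reverse_plan_def using integrable_distr_eq[OF T f] by (simp add: split_beta')
  show "(\<integral>p. (norm (snd p))\<^sup>2 \<partial>reverse_plan \<pi>) = (\<integral>p. (norm (snd p))\<^sup>2 \<partial>\<pi>)"
    unfolding reverse_plan_def using integral_distr[OF T f] by (simp add: split_beta')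
qed

lemma reverse_plan_in_plans: "\<pi> \<in> plans \<Longrightarrow> reverse_plan \<pi> \<in> plans"
  by (simp add: plans_iff reverse_plan_in_prob_measures second_moment_reverse_plan)

lemma penalized_reverse_plan:
  "\<pi> \<in> prob_measures \<Longrightarrow> penalized B A e (reverse_plan \<pi>) = penalized A B e \<pi>"
  by (simp add: penalized_def distr_fst_reverse_plan exp_push_reverse_plan second_moment_reverse_plan)

lemma maximal_plan_reverse:
  assumes "maximal_plan A B e \<pi>"
  shows "maximal_plan B A e (reverse_plan \<pi>)"
  unfolding maximal_plan_def
proof (intro conjI ballI)
  have \<pi>: "\<pi> \<in> plans" using assms by (simp add: maximal_plan_def)
  then show "reverse_plan \<pi> \<in> plans" by (rule reverse_plan_in_plans)
  fix \<sigma> :: "('a torus \<times> (real ^ 'a)) measure" assume \<sigma>: "\<sigma> \<in> plans"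
  have "penalized B A e \<sigma> = penalized A B e (reverse_plan \<sigma>)"
    using \<sigma> by (simp add: penalized_reverse_plan plans_iff)
  also have "\<dots> \<le> penalized A B e \<pi>"
    using assms reverse_plan_in_plans[OF \<sigma>] by (simp add: maximal_plan_def)
  also have "\<dots> = penalized B A e (reverse_plan \<pi>)"
    using \<pi> by (simp add: penalized_reverse_plan plans_iff)
  finally show "penalized B A e \<sigma> \<le> penalized B A e (reverse_plan \<pi>)" .
qed

lemma modulus_of_continuity_linear:
  assumes "c \<ge> 0"
  shows "modulus_of_continuity (\<lambda>t. c * t)"
proof -
  have "\<exists>a b. (deriv ^^ k) (\<lambda>t. c * t) = (\<lambda>t. a * t + b)" for k
  proof (induction k)
    case 0
    then show ?case by (intro exI[of _ c] exI[of _ 0]) simp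
  next
    case (Suc k)
    then obtain a b where ab: "(deriv ^^ k) (\<lambda>t. c * t) = (\<lambda>t. a * t + b)" by blast
    have "deriv (\<lambda>t. a * t + b) t = a" for t
      by (rule DERIV_imp_deriv) (auto intro!: derivative_eq_intros)
    then show ?case by (intro exI[of _ 0] exI[of _ a]) (simp add: ab fun_eq_iff)
  qed
  then have "(deriv ^^ k) (\<lambda>t. c * t) field_differentiable at t" for k t
  proof -
    obtain a b where "(deriv ^^ k) (\<lambda>t. c * t) = (\<lambda>t. a * t + b)"
      using \<open>\<exists>a b. (deriv ^^ k) (\<lambda>t. c * t) = (\<lambda>t. a * t + b)\<close> by blast
    then show ?thesis by (auto intro!: derivative_intros)
  qed
  moreover have "concave_on {0..} (\<lambda>t. c * t)"
    by (auto simp: concave_on_iff algebra_simps)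
  ultimately show ?thesis using assms
    by (auto simp: modulus_of_continuity_def mono_on_def mult_left_mono intro!: continuous_intros)
qed

text \<open>Given a coupling \<open>\<Gamma>\<close> of the momentum \<open>z = -w/e\<close> and a displacement \<open>v\<close>, the plan that starts at
  \<open>exp(x, v)\<close> and moves by \<open>w - v = -(e z + v)\<close> has the end point of \<open>\<pi>\<close>, so only the start and the
  penalty change. Maximality bounds the increase of \<open>A\<close> by the increase of the penalty,
  \<open>(|e z + v|\<^sup>2 - |e z|\<^sup>2) / 2e = z \<bullet> v + |v|\<^sup>2 / 2e\<close>, which is what the super-differential
  inequality asks for.\<close>
lemma maximal_plan_superdiff:
  fixes A B :: "'n::finite torus measure \<Rightarrow> real"
  assumes max: "maximal_plan A B e \<pi>" and supp: "AE p in \<pi>. snd p \<in> K" and K: "compact K"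
    and e: "e > 0"
  obtains \<psi> where "\<psi> \<in> superdiff A (distr \<pi> borel fst)" "\<psi> \<in> borel \<rightarrow>\<^sub>M prob_algebra borel"
    "kernel_prod (distr \<pi> borel fst) \<psi> = distr \<pi> borel (\<lambda>p. (fst p, - (1 / e) *\<^sub>R snd p))"
proof -
  have \<pi>: "\<pi> \<in> prob_measures" "integrable \<pi> (\<lambda>p. (norm (snd p))\<^sup>2)"
    using max by (auto simp: maximal_plan_def plans_iff)
  interpret \<pi>: prob_space \<pi> using \<pi>(1) by (simp add: prob_measures_def)
  define \<mu> where "\<mu> = distr \<pi> borel fst"
  have \<mu>: "\<mu> \<in> prob_measures" unfolding \<mu>_def using \<pi>(1) borel_measurable_fst by (rule distr_in_prob_measures)
  define T where "T p = (fst p, - (1 / e) *\<^sub>R snd p)" for p :: "'n torus \<times> (real ^ 'n)"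
  have T: "T \<in> borel \<rightarrow>\<^sub>M borel" unfolding T_def by (rule borel_measurable_Pair) measurable
  have T': "T \<in> \<pi> \<rightarrow>\<^sub>M borel" unfolding prob_measuresD(3)[OF \<pi>(1)] by (rule T)
  define \<sigma> where "\<sigma> = distr \<pi> borel T"
  have \<sigma>: "\<sigma> \<in> prob_measures" unfolding \<sigma>_def using \<pi>(1) T by (rule distr_in_prob_measures)
  have \<sigma>_fst: "distr \<sigma> borel fst = \<mu>"
    unfolding \<sigma>_def \<mu>_def by (subst distr_distr[OF borel_measurable_fst T']) (simp add: T_def o_def)
  define K' where "K' = (\<lambda>w. - (1 / e) *\<^sub>R w) ` K"
  have K': "compact K'" unfolding K'_def
    using K by (intro compact_continuous_image continuous_intros)
  have "AE p in \<sigma>. snd p \<in> K'"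
  proof -
    have "closed (snd -` K' :: ('n torus \<times> (real ^ 'n)) set)"
      using compact_imp_closed[OF K'] continuous_on_snd[OF continuous_on_id]
      by (intro closed_vimage) auto
    then have "{p \<in> space borel. snd p \<in> K'} \<in> sets (borel :: ('n torus \<times> (real ^ 'n)) measure)"
      by (simp add: vimage_def)
    then have "(AE p in \<sigma>. snd p \<in> K') \<longleftrightarrow> (AE p in \<pi>. snd (T p) \<in> K')"
      unfolding \<sigma>_def by (rule AE_distr_iff[OF T'])
    moreover have "AE p in \<pi>. snd (T p) \<in> K'"
      using supp by eventually_elim (auto simp: T_def K'_def)
    ultimately show ?thesis by simp
  qed
  with disintegration_over_torus[OF \<sigma> K'] obtain \<psi> where
    \<psi>: "\<psi> \<in> borel \<rightarrow>\<^sub>M prob_algebra borel" "kernel_prod (distr \<sigma> borel fst) \<psi> = \<sigma>" by blast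
  then have kp: "kernel_prod \<mu> \<psi> = \<sigma>" by (simp add: \<sigma>_fst)
  have sq: "(\<lambda>p :: 'n torus \<times> (real ^ 'n). (norm (snd p))\<^sup>2) \<in> borel_measurable borel" by measurable
  have \<sigma>_int: "integrable \<sigma> (\<lambda>p. (norm (snd p))\<^sup>2)"
    unfolding \<sigma>_def integrable_distr_eq[OF T' sq]
    using \<pi>(2) e by (simp add: T_def power_divide)
  have \<sigma>_eq: "e\<^sup>2 * (\<integral>p. (norm (snd p))\<^sup>2 \<partial>\<sigma>) = (\<integral>p. (norm (snd p))\<^sup>2 \<partial>\<pi>)"
    unfolding \<sigma>_def integral_distr[OF T' sq] using e by (simp add: T_def power_divide)
  have "\<psi> \<in> superdiff A \<mu>"
    unfolding superdiff_def mem_Collect_eq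
  proof (intro conjI exI[of _ "\<lambda>t. 1 / (2 * e) * t"] ballI impI)
    show "\<psi> \<in> borel \<rightarrow>\<^sub>M prob_algebra borel" by (rule \<psi>(1))
    show "modulus_of_continuity (\<lambda>t. 1 / (2 * e) * t)"
      using e by (intro modulus_of_continuity_linear) simp
    have "(\<integral>\<^sup>+x. \<integral>\<^sup>+z. ennreal ((norm z)\<^sup>2) \<partial>\<psi> x \<partial>\<mu>) = (\<integral>\<^sup>+p. ennreal ((norm (snd p))\<^sup>2) \<partial>\<sigma>)"
      using nn_integral_kernel_prod[OF \<psi>(1) \<mu>, of "\<lambda>p. ennreal ((norm (snd p))\<^sup>2)"] kp by simp
    then show "(\<integral>\<^sup>+x. \<integral>\<^sup>+z. ennreal ((norm z)\<^sup>2) \<partial>\<psi> x \<partial>\<mu>) < \<infinity>"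
      using \<sigma>_int integrable_iff_second_moment[OF \<sigma> borel_measurable_snd] by simp
    fix \<eta> :: "('n torus \<times> (real ^ 'n)) measure" and \<Gamma> :: "('n torus \<times> (real ^ 'n) \<times> (real ^ 'n)) measure"
    assume \<eta>: "\<eta> \<in> prob_measures" and \<Gamma>: "\<Gamma> \<in> prob_measures"
      and *: "finite_second_moment \<eta> \<and> distr \<eta> borel fst = \<mu> \<and>
        distr \<Gamma> borel (\<lambda>(x, z, v). (x, z)) = kernel_prod \<mu> \<psi> \<and>
        distr \<Gamma> borel (\<lambda>(x, z, v). (x, v)) = \<eta>"
    have \<Gamma>z: "distr \<Gamma> borel (\<lambda>g. (fst g, fst (snd g))) = \<sigma>"
      and \<Gamma>v: "distr \<Gamma> borel (\<lambda>g. (fst g, snd (snd g))) = \<eta>"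
      using * kp by (simp_all add: split_beta')
    note \<Gamma>m = prob_measuresD(3)[OF \<Gamma>]
    have x: "(\<lambda>g. fst g) \<in> \<Gamma> \<rightarrow>\<^sub>M borel" and z: "(\<lambda>g. fst (snd g)) \<in> \<Gamma> \<rightarrow>\<^sub>M borel"
      and v: "(\<lambda>g. snd (snd g)) \<in> \<Gamma> \<rightarrow>\<^sub>M borel"
      unfolding \<Gamma>m by measurable
    have xz: "(\<lambda>g. (fst g, fst (snd g))) \<in> \<Gamma> \<rightarrow>\<^sub>M borel" using x z by (rule borel_measurable_Pair)
    have xv: "(\<lambda>g. (fst g, snd (snd g))) \<in> \<Gamma> \<rightarrow>\<^sub>M borel" using x v by (rule borel_measurable_Pair)
    have z2: "integrable \<Gamma> (\<lambda>g. (norm (fst (snd g)))\<^sup>2)"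
      using \<sigma>_int unfolding \<Gamma>z[symmetric] integrable_distr_eq[OF xz sq] by simp
    have z2e: "(\<integral>g. (norm (fst (snd g)))\<^sup>2 \<partial>\<Gamma>) = (\<integral>p. (norm (snd p))\<^sup>2 \<partial>\<sigma>)"
      unfolding \<Gamma>z[symmetric] integral_distr[OF xz sq] by simp
    have \<eta>_int: "integrable \<eta> (\<lambda>p. (norm (snd p))\<^sup>2)"
      using * \<eta> plans_iff by (auto simp: plans_def)
    then have v2: "integrable \<Gamma> (\<lambda>g. (norm (snd (snd g)))\<^sup>2)"
      unfolding \<Gamma>v[symmetric] integrable_distr_eq[OF xv sq] by simp
    have v2e: "(\<integral>g. (norm (snd (snd g)))\<^sup>2 \<partial>\<Gamma>) = (\<integral>p. (norm (snd p))\<^sup>2 \<partial>\<eta>)"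
      unfolding \<Gamma>v[symmetric] integral_distr[OF xv sq] by simp
    have zv: "integrable \<Gamma> (\<lambda>g. fst (snd g) \<bullet> snd (snd g))"
    proof (rule Bochner_Integration.integrable_bound[OF Bochner_Integration.integrable_add[OF z2 v2]])
      show "(\<lambda>g. fst (snd g) \<bullet> snd (snd g)) \<in> borel_measurable \<Gamma>" using z v by measurable
      have "\<bar>a \<bullet> b\<bar> \<le> (norm a)\<^sup>2 + (norm b)\<^sup>2" for a b :: "real ^ 'n"
      proof -
        have "\<bar>a \<bullet> b\<bar> \<le> norm a * norm b" by (rule Cauchy_Schwarz_ineq2)
        also have "\<dots> \<le> (norm a)\<^sup>2 + (norm b)\<^sup>2"
        proof -
          have "0 \<le> norm a * norm b" by simp
          moreover have "2 * (norm a * norm b) \<le> (norm a)\<^sup>2 + (norm b)\<^sup>2"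
            using sum_squares_bound[of "norm a" "norm b"] by (simp add: mult.assoc)
          ultimately show ?thesis by linarith
        qed
        finally show ?thesis .
      qed
      then show "AE g in \<Gamma>. norm (fst (snd g) \<bullet> snd (snd g)) \<le> norm ((norm (fst (snd g)))\<^sup>2 + (norm (snd (snd g)))\<^sup>2)"
        by (intro AE_I2) (simp add: abs_of_nonneg)
    qed
    \<comment> \<open>Follow \<open>v\<close> first, then go on to the old end point \<open>exp (x, - e z)\<close>.\<close>
    define R where "R g = (torus_exp (fst g) (snd (snd g)), - (e *\<^sub>R fst (snd g)) - snd (snd g))"
      for g :: "'n torus \<times> (real ^ 'n) \<times> (real ^ 'n)"
    have R: "R \<in> borel \<rightarrow>\<^sub>M borel" unfolding R_def by (rule borel_measurable_Pair) measurable
    then have R': "R \<in> \<Gamma> \<rightarrow>\<^sub>M borel" unfolding \<Gamma>m .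
    define \<pi>' where "\<pi>' = distr \<Gamma> borel R"
    have \<pi>'p: "\<pi>' \<in> prob_measures" unfolding \<pi>'_def using \<Gamma> R by (rule distr_in_prob_measures)
    have expand: "(norm (snd (R g)))\<^sup>2 = e\<^sup>2 * (norm (fst (snd g)))\<^sup>2 +
        2 * e * (fst (snd g) \<bullet> snd (snd g)) + (norm (snd (snd g)))\<^sup>2" for g
      unfolding R_def power2_norm_eq_inner
      by (simp add: inner_diff_left inner_diff_right inner_commute algebra_simps power2_eq_square)
    have \<pi>'_int: "integrable \<pi>' (\<lambda>p. (norm (snd p))\<^sup>2)"
      unfolding \<pi>'_def integrable_distr_eq[OF R' sq] expand using z2 v2 zv by simp
    have \<pi>'_eq: "(\<integral>p. (norm (snd p))\<^sup>2 \<partial>\<pi>') = (\<integral>p. (norm (snd p))\<^sup>2 \<partial>\<pi>) +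
        2 * e * (\<integral>g. fst (snd g) \<bullet> snd (snd g) \<partial>\<Gamma>) + (\<integral>p. (norm (snd p))\<^sup>2 \<partial>\<eta>)"
      unfolding \<pi>'_def integral_distr[OF R' sq] expand using z2 v2 zv
      by (simp add: z2e v2e \<sigma>_eq)
    have "distr \<pi>' borel fst = exp_push \<eta>"
      unfolding \<pi>'_def exp_push_def \<Gamma>v[symmetric] distr_distr[OF borel_measurable_fst R']
        distr_distr[OF measurable_exp_pair xv]
      by (simp add: R_def o_def)
    moreover have "exp_push \<pi>' = exp_push \<pi>"
    proof -
      have E: "(\<lambda>p :: 'n torus \<times> (real ^ 'n). torus_exp (fst p) (- (e *\<^sub>R snd p))) \<in> borel \<rightarrow>\<^sub>M borel"
        by measurable
      have "exp_push \<pi>' = distr \<Gamma> borel (\<lambda>g. torus_exp (fst g) (- (e *\<^sub>R fst (snd g))))"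
        unfolding \<pi>'_def exp_push_def distr_distr[OF measurable_exp_pair R']
        by (simp add: R_def o_def torus_exp_torus_exp)
      also have "\<dots> = distr \<sigma> borel (\<lambda>p. torus_exp (fst p) (- (e *\<^sub>R snd p)))"
        unfolding \<Gamma>z[symmetric] distr_distr[OF E xz] by (simp add: o_def)
      also have "\<dots> = exp_push \<pi>"
        unfolding \<sigma>_def exp_push_def distr_distr[OF E T'] using e by (simp add: T_def o_def split_beta')
      finally show ?thesis .
    qed
    moreover have "penalized A B e \<pi>' \<le> penalized A B e \<pi>"
      using max \<pi>'p \<pi>'_int by (simp add: maximal_plan_def plans_iff)
    ultimately have "A (exp_push \<eta>) \<le> A \<mu> + (\<integral>g. fst (snd g) \<bullet> snd (snd g) \<partial>\<Gamma>) +
        (\<integral>p. (norm (snd p))\<^sup>2 \<partial>\<eta>) / (2 * e)"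
      using e by (simp add: penalized_def \<pi>'_eq \<mu>_def add_divide_distrib)
    moreover have "cost \<eta> * (1 / (2 * e) * cost \<eta>) = (\<integral>p. (norm (snd p))\<^sup>2 \<partial>\<eta>) / (2 * e)"
      by (simp add: cost_def)
    ultimately show "A (exp_push \<eta>) \<le> A \<mu> + (\<integral>(x, z, v). z \<bullet> v \<partial>\<Gamma>) + cost \<eta> * (1 / (2 * e) * cost \<eta>)"
      by (simp only: split_beta')
  qed
  then show thesis using that \<psi>(1) kp by (simp add: \<mu>_def \<sigma>_def T_def[abs_def])
qed

section \<open>The comparison principle\<close>

text \<open>Beyond the point \<open>c\<close> where \<open>\<omega>\<close> is still below \<open>\<delta>\<close>, concavity keeps \<open>\<omega>\<close> below the line through
  the origin and \<open>(c, \<omega> c)\<close>. The bound can be integrated term by term and so stands in for Jensen's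
  inequality.\<close>
lemma modulus_of_continuity_affine_bound:
  assumes "modulus_of_continuity \<omega>" "\<delta> > 0"
  obtains K where "K \<ge> 0" "\<And>t. t \<ge> 0 \<Longrightarrow> \<omega> t \<le> \<delta> + K * t"
proof -
  have pos: "\<omega> t \<ge> 0" if "t \<ge> 0" for t
    using assms(1) that by (auto simp: modulus_of_continuity_def Pi_iff)
  have "continuous_on {0..} \<omega>" "\<omega> 0 = 0" and conc: "concave_on {0..} \<omega>"
    using assms(1) by (auto simp: modulus_of_continuity_def)
  then obtain d where d: "d > 0" "\<And>t. t \<ge> 0 \<Longrightarrow> dist t 0 < d \<Longrightarrow> dist (\<omega> t) 0 < \<delta>"
    using assms(2) unfolding continuous_on_iff by (metis atLeast_iff order_refl)
  define c where "c = d / 2"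
  have c: "c > 0" using d(1) by (simp add: c_def)
  have small: "\<omega> t \<le> \<delta>" if "0 \<le> t" "t \<le> c" for t
    using d(2)[of t] that d(1) by (simp add: dist_real_def c_def)
  have large: "\<omega> t \<le> \<omega> c / c * t" if "t > c" for t
  proof -
    have "(1 - c / t) * \<omega> 0 + c / t * \<omega> t \<le> \<omega> ((1 - c / t) *\<^sub>R 0 + (c / t) *\<^sub>R t)"
      using that c by (intro concave_onD[OF conc]) auto
    then have "c / t * \<omega> t \<le> \<omega> c" using that c \<open>\<omega> 0 = 0\<close> by simp
    then show ?thesis using that c by (simp add: field_simps)
  qed
  show thesis
  proof (rule that[of "\<omega> c / c"])
    show K: "\<omega> c / c \<ge> 0" using pos[of c] c by simp
    fix t :: real assume t: "t \<ge> 0"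
    have "0 \<le> \<omega> c / c * t" using K t by (rule mult_nonneg_nonneg)
    then show "\<omega> t \<le> \<delta> + \<omega> c / c * t"
      using small[of t] large[of t] t assms(2) by (cases "t \<le> c") auto
  qed
qed

text \<open>A plan induces a coupling of its two ends, and the distance between \<open>x\<close> and \<open>exp(x, w)\<close> is at
  most the length of \<open>w\<close>.\<close>
lemma wasserstein2_le_plan_cost:
  fixes \<pi> :: "('n::finite torus \<times> (real ^ 'n)) measure"
  assumes \<pi>: "\<pi> \<in> plans"
  shows "0 \<le> wasserstein2 (distr \<pi> borel fst) (exp_push \<pi>)"
    and "wasserstein2 (distr \<pi> borel fst) (exp_push \<pi>) \<le> sqrt (\<integral>p. (norm (snd p))\<^sup>2 \<partial>\<pi>)"
proof -
  let ?C = "couplings (distr \<pi> borel fst) (exp_push \<pi>)"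
  let ?c = "\<lambda>\<gamma>. \<integral>p. (dist (fst p) (snd p))\<^sup>2 \<partial>\<gamma>"
  have \<pi>p: "\<pi> \<in> prob_measures" and int: "integrable \<pi> (\<lambda>p. (norm (snd p))\<^sup>2)"
    using \<pi> by (auto simp: plans_iff)
  define T where "T p = (fst p, torus_exp (fst p) (snd p))" for p :: "'n torus \<times> (real ^ 'n)"
  have T: "T \<in> borel \<rightarrow>\<^sub>M borel" unfolding T_def by (rule borel_measurable_Pair) measurable
  then have T': "T \<in> \<pi> \<rightarrow>\<^sub>M borel" unfolding prob_measuresD(3)[OF \<pi>p] .
  have \<gamma>: "distr \<pi> borel T \<in> ?C"
    unfolding couplings_def mem_Collect_eq
  proof (intro conjI)
    show "distr \<pi> borel T \<in> prob_measures" using \<pi>p T by (rule distr_in_prob_measures)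
    show "distr (distr \<pi> borel T) borel fst = distr \<pi> borel fst"
      unfolding distr_distr[OF borel_measurable_fst T'] by (simp add: T_def o_def)
    show "distr (distr \<pi> borel T) borel snd = exp_push \<pi>"
      unfolding distr_distr[OF borel_measurable_snd T'] exp_push_def by (simp add: T_def o_def split_beta')
  qed
  have dm: "(\<lambda>p :: 'n torus \<times> 'n torus. (dist (fst p) (snd p))\<^sup>2) \<in> borel_measurable borel"
    by (intro borel_measurable_continuous_onI continuous_intros)
  have nn: "0 \<le> ?c \<gamma>" for \<gamma> :: "('n torus \<times> 'n torus) measure" by simp
  then have "0 \<le> (INF \<gamma>\<in>?C. ?c \<gamma>)" using \<gamma> by (intro cINF_greatest) auto
  then show "0 \<le> wasserstein2 (distr \<pi> borel fst) (exp_push \<pi>)" by (simp add: wasserstein2_def)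
  have "(INF \<gamma>\<in>?C. ?c \<gamma>) \<le> ?c (distr \<pi> borel T)"
    using nn by (intro cINF_lower[OF _ \<gamma>] bdd_belowI2[of _ 0])
  also have "\<dots> = (\<integral>p. (dist (fst p) (torus_exp (fst p) (snd p)))\<^sup>2 \<partial>\<pi>)"
    unfolding integral_distr[OF T' dm] by (simp add: T_def)
  also have "\<dots> \<le> (\<integral>p. (norm (snd p))\<^sup>2 \<partial>\<pi>)"
  proof (rule integral_mono[OF _ int])
    show le: "(dist (fst p) (torus_exp (fst p) (snd p)))\<^sup>2 \<le> (norm (snd p))\<^sup>2"
      for p :: "'n torus \<times> (real ^ 'n)"
      by (intro power_mono dist_torus_exp_self_le) simp
    show "integrable \<pi> (\<lambda>p. (dist (fst p) (torus_exp (fst p) (snd p)))\<^sup>2)"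
    proof (rule Bochner_Integration.integrable_bound[OF int])
      show "(\<lambda>p. (dist (fst p) (torus_exp (fst p) (snd p)))\<^sup>2) \<in> borel_measurable \<pi>"
        using measurable_compose[OF T' dm] by (simp add: T_def)
    qed (use le in simp)
  qed
  finally show "wasserstein2 (distr \<pi> borel fst) (exp_push \<pi>) \<le> sqrt (\<integral>p. (norm (snd p))\<^sup>2 \<partial>\<pi>)"
    by (simp add: wasserstein2_def)
qed

lemma integral_distr_of_integrable:
  fixes f :: "'b::topological_space \<Rightarrow> real"
  assumes "T \<in> M \<rightarrow>\<^sub>M borel" "integrable (distr M borel T) f"
  shows "integrable M (\<lambda>x. f (T x))" "(\<integral>y. f y \<partial>distr M borel T) = (\<integral>x. f (T x) \<partial>M)"
proof -
  have "f \<in> borel_measurable borel"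
    using borel_measurable_integrable[OF assms(2)] by simp
  then show "(\<integral>y. f y \<partial>distr M borel T) = (\<integral>x. f (T x) \<partial>M)"
    by (rule integral_distr[OF assms(1)])
  show "integrable M (\<lambda>x. f (T x))" by (rule integrable_distr[OF assms])
qed

text \<open>For the reversed plan the displacement is \<open>-w\<close>, hence the super-differential of \<open>-V\<close> at \<open>\<nu>\<close> is the
  conditional law of \<open>w/e\<close>. The sign change in the definition of the sub-differential turns it back
  into \<open>-w/e\<close>: both solutions are tested with the same momentum under the same plan.\<close>
lemma viscosity_gap_le_hamiltonian_gap:
  fixes H :: "'n::finite torus \<Rightarrow> real ^ 'n \<Rightarrow> 'n torus measure \<Rightarrow> real"
  assumes U: "viscosity_subsolution H U" and V: "viscosity_supersolution H V" and e: "e > 0"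
    and max: "maximal_plan U (\<lambda>\<nu>. - V \<nu>) e \<pi>" and supp: "AE p in \<pi>. snd p \<in> unit_cell"
  defines "\<mu> \<equiv> distr \<pi> borel fst" and "\<nu> \<equiv> exp_push \<pi>"
  shows "integrable \<pi> (\<lambda>p. H (torus_exp (fst p) (snd p)) (- (1 / e) *\<^sub>R snd p) \<nu>
        - H (fst p) (- (1 / e) *\<^sub>R snd p) \<mu>)"
    and "U \<mu> - V \<nu> \<le> (\<integral>p. H (torus_exp (fst p) (snd p)) (- (1 / e) *\<^sub>R snd p) \<nu>
        - H (fst p) (- (1 / e) *\<^sub>R snd p) \<mu> \<partial>\<pi>)"
proof -
  have \<pi>: "\<pi> \<in> prob_measures" using max by (simp add: maximal_plan_def plans_iff)
  have \<mu>: "\<mu> \<in> prob_measures"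
    unfolding \<mu>_def using \<pi> borel_measurable_fst by (rule distr_in_prob_measures)
  have \<nu>: "\<nu> \<in> prob_measures"
    unfolding \<nu>_def exp_push_def using \<pi> measurable_exp_pair by (rule distr_in_prob_measures)
  note \<pi>m = prob_measuresD(3)[OF \<pi>]
  define S where "S p = (fst p, - (1 / e) *\<^sub>R snd p)" for p :: "'n torus \<times> (real ^ 'n)"
  define T where "T p = (torus_exp (fst p) (snd p), - (1 / e) *\<^sub>R snd p)" for p :: "'n torus \<times> (real ^ 'n)"
  have S: "S \<in> \<pi> \<rightarrow>\<^sub>M borel" and T: "T \<in> \<pi> \<rightarrow>\<^sub>M borel"
    unfolding \<pi>m S_def T_def by ((rule borel_measurable_Pair; measurable)+)
  have "\<exists>\<psi>. \<psi> \<in> superdiff U \<mu> \<and> kernel_prod \<mu> \<psi> = distr \<pi> borel S"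
    unfolding \<mu>_def S_def[abs_def]
    by (rule maximal_plan_superdiff[OF max supp compact_unit_cell e]) (intro exI conjI; assumption)
  then obtain \<psi> where \<psi>: "\<psi> \<in> superdiff U \<mu>" "kernel_prod \<mu> \<psi> = distr \<pi> borel S" by (elim exE conjE)
  have "\<forall>\<psi>\<in>superdiff U \<mu>. integrable (kernel_prod \<mu> \<psi>) (\<lambda>q. H (fst q) (snd q) \<mu>) \<and>
      U \<mu> + (\<integral>q. H (fst q) (snd q) \<mu> \<partial>kernel_prod \<mu> \<psi>) \<le> 0"
    using U \<mu> by (simp add: viscosity_subsolution_def split_beta')
  from bspec[OF this \<psi>(1)]
  have subU: "integrable (distr \<pi> borel S) (\<lambda>q. H (fst q) (snd q) \<mu>)"
    "U \<mu> + (\<integral>q. H (fst q) (snd q) \<mu> \<partial>distr \<pi> borel S) \<le> 0"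
    by (simp_all add: \<psi>(2))
  define \<rho> where "\<rho> = reverse_plan \<pi>"
  have \<rho>: "\<rho> \<in> prob_measures" unfolding \<rho>_def using \<pi> by (rule reverse_plan_in_prob_measures)
  have \<rho>_fst: "distr \<rho> borel fst = \<nu>" unfolding \<rho>_def \<nu>_def using \<pi> by (rule distr_fst_reverse_plan)
  have max': "maximal_plan (\<lambda>\<nu>. - V \<nu>) U e \<rho>" unfolding \<rho>_def using max by (rule maximal_plan_reverse)
  have supp': "AE p in \<rho>. snd p \<in> uminus ` unit_cell"
  proof -
    have "closed (snd -` (uminus ` unit_cell) :: ('n torus \<times> (real ^ 'n)) set)"
      using compact_imp_closed[OF compact_continuous_image[OF continuous_on_minus[OF continuous_on_id] compact_unit_cell]]
        continuous_on_snd[OF continuous_on_id] by (intro closed_vimage) auto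
    then have "Measurable.pred borel (\<lambda>p :: 'n torus \<times> (real ^ 'n). snd p \<in> uminus ` unit_cell)"
      by (simp add: pred_def vimage_def)
    from AE_reverse_plan[OF \<pi> this] supp show ?thesis unfolding \<rho>_def by auto
  qed
  have K': "compact (uminus ` unit_cell :: (real ^ 'n) set)"
    by (intro compact_continuous_image compact_unit_cell continuous_intros)
  have "\<exists>\<phi>. \<phi> \<in> superdiff (\<lambda>\<nu>. - V \<nu>) \<nu> \<and> \<phi> \<in> borel \<rightarrow>\<^sub>M prob_algebra borel \<and>
      kernel_prod \<nu> \<phi> = distr \<rho> borel S"
    unfolding \<rho>_fst[symmetric] S_def[abs_def]
    by (rule maximal_plan_superdiff[OF max' supp' K' e]) (intro exI conjI; assumption)
  then obtain \<phi> where \<phi>: "\<phi> \<in> superdiff (\<lambda>\<nu>. - V \<nu>) \<nu>" "\<phi> \<in> borel \<rightarrow>\<^sub>M prob_algebra borel"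
      "kernel_prod \<nu> \<phi> = distr \<rho> borel S"
    by (elim exE conjE)
  define \<phi>' where "\<phi>' x = distr (\<phi> x) borel uminus" for x
  have sub: "\<phi>' \<in> subdiff V \<nu>" unfolding subdiff_def \<phi>'_def using \<phi>(1) by blast
  have "kernel_prod \<nu> \<phi>' = distr (distr \<rho> borel S) borel (\<lambda>p. (fst p, - snd p))"
    unfolding \<phi>'_def using kernel_prod_uminus[OF \<phi>(2) \<nu>] \<phi>(3) by simp
  also have "\<dots> = distr \<rho> borel (\<lambda>p. (fst p, (1 / e) *\<^sub>R snd p))"
  proof -
    have "(\<lambda>p :: 'n torus \<times> (real ^ 'n). (fst p, - snd p)) \<in> borel \<rightarrow>\<^sub>M borel"
      by (rule borel_measurable_Pair) measurable
    moreover have "S \<in> \<rho> \<rightarrow>\<^sub>M borel" using S unfolding prob_measuresD(3)[OF \<rho>] \<pi>m .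
    ultimately show ?thesis by (simp add: distr_distr S_def o_def)
  qed
  also have "\<dots> = distr \<pi> borel T"
  proof -
    have "(\<lambda>p :: 'n torus \<times> (real ^ 'n). (fst p, (1 / e) *\<^sub>R snd p)) \<in> borel \<rightarrow>\<^sub>M borel"
      by (rule borel_measurable_Pair) measurable
    from distr_reverse_plan[OF \<pi> this] show ?thesis by (simp add: \<rho>_def T_def[abs_def])
  qed
  finally have kp: "kernel_prod \<nu> \<phi>' = distr \<pi> borel T" .
  have "\<forall>\<psi>\<in>subdiff V \<nu>. integrable (kernel_prod \<nu> \<psi>) (\<lambda>q. H (fst q) (snd q) \<nu>) \<and>
      V \<nu> + (\<integral>q. H (fst q) (snd q) \<nu> \<partial>kernel_prod \<nu> \<psi>) \<ge> 0"
    using V \<nu> by (simp add: viscosity_supersolution_def split_beta')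
  from bspec[OF this sub] have supV: "integrable (distr \<pi> borel T) (\<lambda>q. H (fst q) (snd q) \<nu>)"
    "V \<nu> + (\<integral>q. H (fst q) (snd q) \<nu> \<partial>distr \<pi> borel T) \<ge> 0"
    by (simp_all add: kp)
  note U' = integral_distr_of_integrable[OF S subU(1)] and V' = integral_distr_of_integrable[OF T supV(1)]
  show "integrable \<pi> (\<lambda>p. H (torus_exp (fst p) (snd p)) (- (1 / e) *\<^sub>R snd p) \<nu>
        - H (fst p) (- (1 / e) *\<^sub>R snd p) \<mu>)"
    using Bochner_Integration.integrable_diff[OF V'(1) U'(1)] by (simp add: S_def T_def)
  have "U \<mu> - V \<nu> \<le> (\<integral>p. H (fst (T p)) (snd (T p)) \<nu> \<partial>\<pi>) - (\<integral>p. H (fst (S p)) (snd (S p)) \<mu> \<partial>\<pi>)"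
    using subU(2) supV(2) unfolding U'(2) V'(2) by linarith
  also have "\<dots> = (\<integral>p. H (fst (T p)) (snd (T p)) \<nu> - H (fst (S p)) (snd (S p)) \<mu> \<partial>\<pi>)"
    by (rule Bochner_Integration.integral_diff[OF V'(1) U'(1), symmetric])
  finally show "U \<mu> - V \<nu> \<le> (\<integral>p. H (torus_exp (fst p) (snd p)) (- (1 / e) *\<^sub>R snd p) \<nu>
        - H (fst p) (- (1 / e) *\<^sub>R snd p) \<mu> \<partial>\<pi>)"
    by (simp add: S_def T_def)
qed

text \<open>The momentum has length \<open>|w|/e\<close> and both distances are controlled by \<open>|w|\<close> and \<open>\<surd>D\<close>, so the
  argument of the modulus is at most \<open>(1 + |w|/e) (|w| + \<surd>D)\<close>, whose integral only involves the first
  two moments of \<open>|w|\<close>.\<close>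
lemma hamiltonian_gap_le:
  fixes H :: "'n::finite torus \<Rightarrow> real ^ 'n \<Rightarrow> 'n torus measure \<Rightarrow> real"
  assumes H: "\<forall>x y q. \<forall>\<mu> \<in> prob_measures. \<forall>\<nu> \<in> prob_measures.
           \<bar>H x q \<mu> - H y q \<nu>\<bar> \<le> \<omega> ((1 + norm q) * (dist x y + wasserstein2 \<mu> \<nu>))"
    and \<omega>: "\<And>t. t \<ge> 0 \<Longrightarrow> \<omega> t \<le> \<delta> + K * t" and K: "K \<ge> 0"
    and e: "e > 0" and \<pi>: "\<pi> \<in> plans"
  defines "\<mu> \<equiv> distr \<pi> borel fst" and "\<nu> \<equiv> exp_push \<pi>" and "D \<equiv> \<integral>p. (norm (snd p))\<^sup>2 \<partial>\<pi>"
  assumes int: "integrable \<pi> (\<lambda>p. H (torus_exp (fst p) (snd p)) (- (1 / e) *\<^sub>R snd p) \<nu>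
        - H (fst p) (- (1 / e) *\<^sub>R snd p) \<mu>)"
  shows "(\<integral>p. H (torus_exp (fst p) (snd p)) (- (1 / e) *\<^sub>R snd p) \<nu>
        - H (fst p) (- (1 / e) *\<^sub>R snd p) \<mu> \<partial>\<pi>) \<le> \<delta> + K * (2 * sqrt D + 2 * (D / e))"
proof -
  have \<pi>p: "\<pi> \<in> prob_measures" and int2: "integrable \<pi> (\<lambda>p. (norm (snd p))\<^sup>2)"
    using \<pi> by (auto simp: plans_iff)
  interpret \<pi>: prob_space \<pi> using \<pi>p by (simp add: prob_measures_def)
  have \<mu>: "\<mu> \<in> prob_measures"
    unfolding \<mu>_def using \<pi>p borel_measurable_fst by (rule distr_in_prob_measures)
  have \<nu>: "\<nu> \<in> prob_measures"
    unfolding \<nu>_def exp_push_def using \<pi>p measurable_exp_pair by (rule distr_in_prob_measures)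
  define W where "W = wasserstein2 \<mu> \<nu>"
  have W: "0 \<le> W" "W \<le> sqrt D"
    unfolding W_def \<mu>_def \<nu>_def D_def using wasserstein2_le_plan_cost[OF \<pi>] by auto
  have D: "D \<ge> 0" unfolding D_def by simp
  have nm: "(\<lambda>p. norm (snd p)) \<in> borel_measurable \<pi>"
    unfolding prob_measuresD(3)[OF \<pi>p] by measurable
  have int1: "integrable \<pi> (\<lambda>p. norm (snd p))"
  proof (rule Bochner_Integration.integrable_bound[OF _ nm])
    show "integrable \<pi> (\<lambda>p. 1 + (norm (snd p))\<^sup>2)" using int2 by simp
    have "t \<le> 1 + t\<^sup>2" for t :: real
    proof -
      have "2 * t \<le> 1 + t\<^sup>2" using sum_squares_bound[of t 1] by simp
      moreover have "0 \<le> 1 + t\<^sup>2" by simp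
      ultimately show ?thesis by linarith
    qed
    then show "AE p in \<pi>. norm (norm (snd p)) \<le> norm (1 + (norm (snd p))\<^sup>2)"
      by (intro AE_I2) (simp add: abs_of_nonneg)
  qed
  define m where "m = (\<integral>p. norm (snd p) \<partial>\<pi>)"
  have "m\<^sup>2 \<le> D"
    using \<pi>.variance_eq[OF int1 int2] \<pi>.variance_positive[of "\<lambda>p. norm (snd p)"] by (simp add: m_def D_def)
  then have m: "m \<le> sqrt D" by (rule real_le_rsqrt)
  have "(\<integral>p. H (torus_exp (fst p) (snd p)) (- (1 / e) *\<^sub>R snd p) \<nu>
        - H (fst p) (- (1 / e) *\<^sub>R snd p) \<mu> \<partial>\<pi>)
      \<le> (\<integral>p. \<delta> + K * (norm (snd p) + sqrt D + (norm (snd p))\<^sup>2 / e + sqrt D / e * norm (snd p)) \<partial>\<pi>)"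
  proof (rule integral_mono[OF int])
    show "integrable \<pi> (\<lambda>p. \<delta> + K * (norm (snd p) + sqrt D + (norm (snd p))\<^sup>2 / e + sqrt D / e * norm (snd p)))"
      using int1 int2 by (intro Bochner_Integration.integrable_add integrable_mult_right
          integrable_divide_zero) auto
    fix p :: "'n torus \<times> (real ^ 'n)"
    define x w where "x = fst p" and "w = snd p"
    define q where "q = - (1 / e) *\<^sub>R w"
    have q: "norm q = norm w / e" using e by (simp add: q_def)
    have "H (torus_exp x w) q \<nu> - H x q \<mu> \<le> \<bar>H x q \<mu> - H (torus_exp x w) q \<nu>\<bar>" by simp
    also have "\<dots> \<le> \<omega> ((1 + norm q) * (dist x (torus_exp x w) + W))"
      using H \<mu> \<nu> by (simp add: W_def)
    also have "\<dots> \<le> \<delta> + K * ((1 + norm q) * (dist x (torus_exp x w) + W))"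
      using W(1) by (intro \<omega> mult_nonneg_nonneg add_nonneg_nonneg) auto
    also have "\<dots> \<le> \<delta> + K * ((1 + norm q) * (norm w + sqrt D))"
      using W(2) K by (intro add_left_mono mult_left_mono add_mono dist_torus_exp_self_le) auto
    also have "(1 + norm q) * (norm w + sqrt D) = norm w + sqrt D + (norm w)\<^sup>2 / e + sqrt D / e * norm w"
      unfolding q by (simp add: algebra_simps add_divide_distrib power2_eq_square)
    finally show "H (torus_exp (fst p) (snd p)) (- (1 / e) *\<^sub>R snd p) \<nu> - H (fst p) (- (1 / e) *\<^sub>R snd p) \<mu>
        \<le> \<delta> + K * (norm (snd p) + sqrt D + (norm (snd p))\<^sup>2 / e + sqrt D / e * norm (snd p))"
      by (simp add: x_def w_def q_def)
  qed
  also have "\<dots> = \<delta> + K * (m + sqrt D + D / e + sqrt D / e * m)"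
    using int1 int2 by (simp add: m_def D_def \<pi>.prob_space)
  also have "\<dots> \<le> \<delta> + K * (sqrt D + sqrt D + D / e + sqrt D / e * sqrt D)"
    using m K e D by (intro add_left_mono mult_left_mono add_mono order_refl) auto
  also have "\<dots> = \<delta> + K * (2 * sqrt D + 2 * (D / e))" using D by simp
  finally show ?thesis .
qed

text \<open>Testing the problem with parameter \<open>2e\<close> by the maximal plan for \<open>e\<close> shows that halving the parameter
  decreases the maximum by at least \<open>D/4e\<close>. The maxima are bounded below, so these decrements tend
  to zero.\<close>
lemma penalization_vanishes:
  fixes A B :: "'n::finite torus measure \<Rightarrow> real"
  assumes max: "\<And>k. maximal_plan A B ((1 / 2) ^ k) (\<pi> k)"
    and lower: "\<And>k. s \<le> penalized A B ((1 / 2) ^ k) (\<pi> k)"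
  shows "(\<lambda>k. (\<integral>p. (norm (snd p))\<^sup>2 \<partial>\<pi> k) / (1 / 2) ^ k) \<longlonglongrightarrow> 0"
proof -
  define D where "D k = (\<integral>p. (norm (snd p))\<^sup>2 \<partial>\<pi> k)" for k
  define M where "M k = penalized A B ((1 / 2) ^ k) (\<pi> k)" for k
  define r where "r k = D k / (1 / 2) ^ k" for k
  have r0: "0 \<le> r k" for k by (simp add: r_def D_def)
  have step: "r (Suc k) / 4 \<le> M k - M (Suc k)" for k
  proof -
    have "penalized A B ((1 / 2) ^ k) (\<pi> (Suc k)) \<le> M k"
      using max[of k] max[of "Suc k"] by (simp add: maximal_plan_def M_def)
    moreover have "penalized A B ((1 / 2) ^ k) (\<pi> (Suc k)) = M (Suc k) + r (Suc k) / 4"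
      by (simp add: penalized_def M_def r_def D_def field_simps)
    ultimately show ?thesis by simp
  qed
  have "decseq M"
  proof (rule decseq_SucI)
    show "M (Suc k) \<le> M k" for k using step[of k] r0[of "Suc k"] by simp
  qed
  moreover have "\<forall>k. s \<le> M k" using lower by (simp add: M_def)
  ultimately obtain L where L: "M \<longlonglongrightarrow> L" by (rule decseq_convergent)
  have "(\<lambda>k. 4 * (M k - M (Suc k))) \<longlonglongrightarrow> 4 * (L - L)"
    by (intro tendsto_intros L LIMSEQ_Suc[OF L])
  then have "(\<lambda>k. 4 * (M k - M (Suc k))) \<longlonglongrightarrow> 0" by simp
  then have "(\<lambda>k. r (Suc k)) \<longlonglongrightarrow> 0"
  proof (rule tendsto_sandwich[OF _ _ tendsto_const, rotated 2])
    show "\<forall>\<^sub>F k in sequentially. r (Suc k) \<le> 4 * (M k - M (Suc k))"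
    proof (rule always_eventually, rule allI)
      show "r (Suc k) \<le> 4 * (M k - M (Suc k))" for k using step[of k] by simp
    qed
  qed (use r0 in simp)
  then show ?thesis unfolding r_def D_def by (rule LIMSEQ_imp_Suc)
qed

text \<open>The plan that does not move bounds the maximum from below by \<open>A \<mu> + B \<mu>\<close>, whatever the penalty.\<close>
lemma stationary_plan:
  fixes \<mu> :: "'n::finite torus measure"
  assumes "\<mu> \<in> prob_measures"
  obtains \<pi> where "\<pi> \<in> plans" "\<And>A B e. penalized A B e \<pi> = A \<mu> + B \<mu>"
proof -
  define T where "T x = (x, 0 :: real ^ 'n)" for x :: "'n torus"
  have T: "T \<in> borel \<rightarrow>\<^sub>M borel" unfolding T_def by (rule borel_measurable_Pair) auto
  then have T': "T \<in> \<mu> \<rightarrow>\<^sub>M borel" unfolding prob_measuresD(3)[OF assms] .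
  have id: "distr \<mu> borel (\<lambda>x. x) = \<mu>" by (rule distr_id2) (simp add: prob_measuresD[OF assms])
  have sq: "(\<lambda>p :: 'n torus \<times> (real ^ 'n). (norm (snd p))\<^sup>2) \<in> borel_measurable borel" by measurable
  have p: "distr \<mu> borel T \<in> prob_measures" using assms T by (rule distr_in_prob_measures)
  have "integrable (distr \<mu> borel T) (\<lambda>p. (norm (snd p))\<^sup>2)"
    unfolding integrable_distr_eq[OF T' sq] by (simp add: T_def)
  then have "distr \<mu> borel T \<in> plans" using p by (simp add: plans_iff)
  moreover have "penalized A B e (distr \<mu> borel T) = A \<mu> + B \<mu>" for A B e
    unfolding penalized_def exp_push_def integral_distr[OF T' sq] distr_distr[OF borel_measurable_fst T']
      distr_distr[OF measurable_exp_pair T']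
    by (simp add: T_def o_def id)
  ultimately show thesis by (rule that)
qed

theorem theorem12p12:
  fixes H :: "'n::finite torus \<Rightarrow> real ^ 'n \<Rightarrow> 'n torus measure \<Rightarrow> real"
    and U V :: "'n torus measure \<Rightarrow> real"
    and \<omega> :: "real \<Rightarrow> real" and C :: real
  assumes "C > 0"
    and "\<forall>x q. \<forall>\<mu> \<in> prob_measures. \<bar>H x q \<mu>\<bar> \<le> C * (1 + (norm q)\<^sup>2)"
    and "modulus_of_continuity \<omega>"
    and "\<forall>x y q. \<forall>\<mu> \<in> prob_measures. \<forall>\<nu> \<in> prob_measures.
           \<bar>H x q \<mu> - H y q \<nu>\<bar> \<le> \<omega> ((1 + norm q) * (dist x y + wasserstein2 \<mu> \<nu>))"
    and "viscosity_subsolution H U"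
    and "viscosity_supersolution H V"
  shows "\<forall>\<mu> \<in> prob_measures. U \<mu> \<le> V \<mu>"
proof (rule ballI, rule ccontr)
  fix \<mu>\<^sub>0 :: "'n torus measure"
  assume \<mu>\<^sub>0: "\<mu>\<^sub>0 \<in> prob_measures" and neg: "\<not> U \<mu>\<^sub>0 \<le> V \<mu>\<^sub>0"
  define s where "s = U \<mu>\<^sub>0 - V \<mu>\<^sub>0"
  have s: "s > 0" using neg by (simp add: s_def)
  define B where "B \<nu> = - V \<nu>" for \<nu>
  have uscU: "weakly_usc U" using assms(5) by (simp add: viscosity_subsolution_def)
  have uscB: "weakly_usc B" unfolding weakly_usc_def
  proof
    fix a
    have "openin weak_topology {\<mu> \<in> prob_measures. - a < V \<mu>}"
      using assms(6) by (simp add: viscosity_supersolution_def weakly_lsc_def)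
    moreover have "{\<mu> \<in> prob_measures. - a < V \<mu>} = {\<mu> \<in> prob_measures. B \<mu> < a}"
      by (auto simp: B_def)
    ultimately show "openin weak_topology {\<mu> \<in> prob_measures. B \<mu> < a}" by simp
  qed
  have "\<exists>\<pi>. maximal_plan U B ((1 / 2) ^ k) \<pi> \<and> (AE p in \<pi>. snd p \<in> unit_cell)" for k :: nat
    using maximal_plan_exists[OF uscU uscB, of "(1 / 2) ^ k"] by auto
  then obtain \<pi> where max: "\<And>k. maximal_plan U B ((1 / 2) ^ k) (\<pi> k)"
    and supp: "\<And>k. AE p in \<pi> k. snd p \<in> unit_cell" by metis
  define D where "D k = (\<integral>p. (norm (snd p))\<^sup>2 \<partial>\<pi> k)" for k
  define r where "r k = D k / (1 / 2) ^ k" for k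
  have D: "0 \<le> D k" "D k \<le> r k" for k
  proof -
    show "0 \<le> D k" by (simp add: D_def)
    then have "D k * 1 \<le> D k * 2 ^ k" by (intro mult_left_mono) auto
    then show "D k \<le> r k" by (simp add: r_def power_one_over)
  qed
  obtain \<pi>\<^sub>0 where \<pi>\<^sub>0: "\<pi>\<^sub>0 \<in> plans" "\<And>A B e. penalized A B e \<pi>\<^sub>0 = A \<mu>\<^sub>0 + B \<mu>\<^sub>0"
    using stationary_plan[OF \<mu>\<^sub>0] by blast
  have lower: "s \<le> penalized U B ((1 / 2) ^ k) (\<pi> k)" for k
    using max[of k] \<pi>\<^sub>0 by (auto simp: maximal_plan_def s_def B_def)
  have r: "r \<longlonglongrightarrow> 0"
    using penalization_vanishes[OF max lower] by (simp add: r_def[abs_def] D_def)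
  obtain K where K: "K \<ge> 0" "\<And>t. t \<ge> 0 \<Longrightarrow> \<omega> t \<le> s / 2 + K * t"
    using modulus_of_continuity_affine_bound[OF assms(3), of "s / 2"] s by auto
  have bound: "s \<le> s / 2 + K * (2 * sqrt (r k) + 2 * r k)" for k
  proof -
    have e: "(1 / 2 :: real) ^ k > 0" by simp
    have pl: "\<pi> k \<in> plans" using max[of k] by (simp add: maximal_plan_def)
    note max' = max[of k, unfolded B_def[abs_def]]
    note gap = viscosity_gap_le_hamiltonian_gap[OF assms(5,6) e max' supp[of k]]
    have "s \<le> U (distr (\<pi> k) borel fst) - V (exp_push (\<pi> k)) - r k / 2"
      using lower[of k] by (simp add: penalized_def B_def r_def D_def)
    also have "\<dots> \<le> U (distr (\<pi> k) borel fst) - V (exp_push (\<pi> k))"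
      using D[of k] by simp
    also have "\<dots> \<le> s / 2 + K * (2 * sqrt (D k) + 2 * r k)"
      using gap(2) hamiltonian_gap_le[OF assms(4) K(2,1) e pl gap(1)] by (simp add: D_def r_def)
    also have "\<dots> \<le> s / 2 + K * (2 * sqrt (r k) + 2 * r k)"
      using D[of k] K(1) by (intro add_left_mono mult_left_mono add_right_mono) auto
    finally show ?thesis .
  qed
  have "(\<lambda>k. s / 2 + K * (2 * sqrt (r k) + 2 * r k)) \<longlonglongrightarrow> s / 2 + K * (2 * sqrt 0 + 2 * 0)"
    by (intro tendsto_intros r)
  from LIMSEQ_le_const[OF this] bound have "s \<le> s / 2 + K * (2 * sqrt 0 + 2 * 0)" by blast
  then show False using s by simp
qed

end
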